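(* Let $d\ge 3$ be an integer and let $(x_n)_{n\ge 1}$ be a sequence of positive real numbers such that, for some $c>0$, $x_{n+1}-x_n\ge c$ for all $n\ge 1$. Assume that there exists $\lambda>0$ such that $$E(X_N)\ll N^{\frac{183}{76}+\frac{16}{76}\left(1-\frac1d\right)-\lambda}\qquad\text{as } N\to\infty .$$ Then for (Lebesgue) almost all $\boldsymbol{\alpha}=(\alpha_1,\dots,\alpha_d)\in\mathbb{R}^d$ the sequence $\big(\{x_n\alpha_1\},\dots,\{x_n\alpha_d\}\big)_{n\ge1}$ in $[0,1)^d$ has $\infty$-PPC.
   Context: $\{t\}$ denotes the fractional part of the real number $t$. Additive energy: for the real sequence $(x_n)$, $E(X_N):=\#\{(n_1,n_2,n_3,n_4)\in\{1,\dots,N\}^4:\ |x_{n_1}+x_{n_2}-x_{n_3}-x_{n_4}|<1\}$. $\infty$-PPC (Poissonian pair correlation with respect to the sup-norm): for a sequence $(\boldsymbol{y}_n)$ in $[0,1)^d$, $s>0$ and $N\in\mathbb{N}$ let $$R^{(d)}_{2,\infty}(s,(\boldsymbol{y}_n),N):=\frac1N\#\Big\{1\le n\ne m\le N:\ \min_{\boldsymbol{k}\in\mathbb{Z}^d}\|\boldsymbol{y}_n-\boldsymbol{y}_m+\boldsymbol{k}\|_\infty\le \frac{s}{N^{1/d}}\Big\},$$ where ordered pairs $(n,m)$ are counted. The sequence $(\boldsymbol{y}_n)$ has $\infty$-PPC if for every $s>0$, $R^{(d)}_{2,\infty}(s,(\boldsymbol{y}_n),N)\to(2s)^d$ as $N\to\infty$.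 *)

theory Defs
  imports "HOL-Analysis.Analysis" "HOL-Library.Landau_Symbols"
begin

text \<open>Sequences are functions on \<^typ>\<open>nat\<close> of which only the values at indices \<open>n \<ge> 1\<close> are used.\<close>

definition additive_energy :: "(nat \<Rightarrow> real) \<Rightarrow> nat \<Rightarrow> nat" where
  "additive_energy x N =
     card {(n1, n2, n3, n4). n1 \<in> {1..N} \<and> n2 \<in> {1..N} \<and> n3 \<in> {1..N} \<and> n4 \<in> {1..N} \<and>
             \<bar>x n1 + x n2 - x n3 - x n4\<bar> < 1}"

text \<open>The minimum over the integer lattice of the sup-norm of \<open>v + k\<close> is attained,
  so it is written as an infimum.\<close>

definition torus_infnorm :: "real ^ 'd \<Rightarrow> real" where
  "torus_infnorm v = (INF k\<in>(UNIV :: (int ^ 'd) set). infnorm (v + (\<chi> i. of_int (k $ i))))"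

definition pair_corr_infnorm :: "real \<Rightarrow> (nat \<Rightarrow> real ^ 'd) \<Rightarrow> nat \<Rightarrow> real" where
  "pair_corr_infnorm s y N =
     1 / real N * real (card {(n, m). n \<in> {1..N} \<and> m \<in> {1..N} \<and> n \<noteq> m \<and>
       torus_infnorm (y n - y m) \<le> s / real N powr (1 / real CARD('d))})"

definition infnorm_PPC :: "(nat \<Rightarrow> real ^ 'd) \<Rightarrow> bool" where
  "infnorm_PPC y \<longleftrightarrow>
     (\<forall>s>0. (\<lambda>N. pair_corr_infnorm s y N) \<longlonglongrightarrow> (2 * s) ^ CARD('d))"

end

theory Submission
  imports Defs "HOL-Probability.Probability"
begin

text \<open>
  The \<open>d\<close>-fold product of a trapezoidal bump \<open>T\<close> of mean \<open>c\<^sub>0 \<asymp> N powr (- 1 / d)\<close> approximates the indicator of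
  a cube from above and below. Its Fourier coefficients are absolutely summable with a sum independent of \<open>N\<close>.
  With respect to a product of Fejer weights, whose Fourier transform is a tent supported in \<open>[-c, c]\<close>,
  the correlation of \<open>T (z \<alpha>)\<close> and \<open>T (z' \<alpha>)\<close>, for differences \<open>z\<close> and \<open>z'\<close> of elements of the sequence,
  is exactly \<open>c\<^sub>0\<^sup>2 + Q z z'\<close> with \<open>Q\<close> a sum over nonzero frequencies only. By Cauchy-Schwarz, the sum of
  \<open>\<bar>Q z z'\<bar>\<close> over all pairs is at most a constant times the additive energy. As the correlation is at most \<open>c\<^sub>0\<close>,
  passing to the \<open>d\<close>-th power gains the factor \<open>c\<^sub>0 ^ (d - 1)\<close>, so the variance of the smoothed pair
  correlation is at most a constant times \<open>N powr (1 / d - 3)\<close> times the energy. For \<open>d \<ge> 3\<close> the exponent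
  assumed for the energy is smaller than \<open>3 - 1 / d\<close>, so this elementary bound already gives a
  power saving, and no estimate for the zeta function is needed. A polynomially growing
  subsequence and monotonicity of the pair counts give the result for almost every \<open>\<alpha>\<close>.
\<close>

section \<open>The Fejer weight\<close>

text \<open>Integration by parts gives the antiderivative \<open>?F\<close>. It tends to 0 at the
  origin and, since \<open>Si\<close> tends to \<open>pi / 2\<close>, to \<open>t * (pi / 2)\<close>
  at infinity. The integrand is nonnegative, so the fundamental theorem yields integrability as well
  as the value.\<close>

lemma has_bochner_integral_one_minus_cos_pos:
  fixes t :: real
  assumes t: "t > 0"
  shows "has_bochner_integral lborel (\<lambda>x. indicator {0<..} x *\<^sub>R ((1 - cos (t * x)) / x\<^sup>2)) (pi * t / 2)"
proof -
  let ?f = "\<lambda>x::real. (1 - cos (t * x)) / x\<^sup>2"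
  let ?F = "\<lambda>x::real. t * Si (t * x) - (1 - cos (t * x)) / x"
  have Dv: "DERIV ?F x :> ?f x" if "x > 0" for x
  proof -
    have 1: "((\<lambda>x. Si (t * x)) has_real_derivative sinc (t * x) * t) (at x)"
      by (rule DERIV_chain2[OF DERIV_Si]) (auto intro!: derivative_eq_intros)
    have 2: "((\<lambda>x. (1 - cos (t * x)) / x) has_real_derivative
        (t * sin (t * x) * x - (1 - cos (t * x))) / x\<^sup>2) (at x)"
      using that by (auto intro!: derivative_eq_intros simp: power2_eq_square)
    show ?thesis
      using that t by (intro DERIV_cong[OF DERIV_diff[OF DERIV_cmult[OF 1] 2]])
        (simp add: field_simps power2_eq_square)
  qed
  have cont: "isCont ?f x" if "x > 0" for x
    using that by (auto intro!: continuous_intros)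
  have lim0: "(?F \<longlongrightarrow> 0) (at_right 0)"
  proof -
    have "((\<lambda>x. Si (t * x)) \<longlongrightarrow> Si (t * 0)) (at 0)"
      by (intro isCont_tendsto_compose[OF isCont_Si] tendsto_intros)
    hence a: "((\<lambda>x. Si (t * x)) \<longlongrightarrow> 0) (at_right 0)"
      by (auto simp: Si_def zero_ereal_def intro: tendsto_within_subset)
    have "((\<lambda>x. (1 - cos (t * x)) / x) \<longlongrightarrow> 0) (at_right 0)"
      using t by real_asymp
    from tendsto_diff[OF tendsto_mult_left[OF a, of t] this] show ?thesis by simp
  qed
  have limt: "(?F \<longlongrightarrow> t * (pi / 2)) at_top"
  proof -
    have "filterlim (\<lambda>x. t * x) at_top at_top" using t by real_asymp
    from filterlim_compose[OF Si_at_top this] have a: "((\<lambda>x. Si (t * x)) \<longlongrightarrow> pi / 2) at_top" .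
    have b: "((\<lambda>x. (1 - cos (t * x)) / x) \<longlongrightarrow> 0) at_top"
    proof (rule Lim_null_comparison)
      show "\<forall>\<^sub>F x in at_top. norm ((1 - cos (t * x)) / x) \<le> 2 / x"
        using eventually_gt_at_top[of 0]
      proof eventually_elim
        case (elim x)
        have "\<bar>1 - cos (t * x)\<bar> \<le> 2" using cos_ge_minus_one[of "t*x"] cos_le_one[of "t*x"] by linarith
        thus ?case using elim by (auto simp: divide_right_mono)
      qed
      show "((\<lambda>x::real. 2 / x) \<longlongrightarrow> 0) at_top" by real_asymp
    qed
    from tendsto_diff[OF tendsto_mult_left[OF a, of t] b] show ?thesis by simp
  qed
  have nn: "AE x in lborel. (0::ereal) < ereal x \<longrightarrow> ereal x < \<infinity> \<longrightarrow> 0 \<le> ?f x"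
    by (auto intro!: AE_I2)
  have l0: "((?F \<circ> real_of_ereal) \<longlongrightarrow> 0) (at_right (0::ereal))"
    using lim0 unfolding zero_ereal_def ereal_tendsto_simps(2)[symmetric]
    by (simp add: ereal_tendsto_simps zero_ereal_def)
  have lt: "((?F \<circ> real_of_ereal) \<longlongrightarrow> t * (pi / 2)) (at_left (\<infinity>::ereal))"
    using limt by (simp add: ereal_tendsto_simps)
  note FTC = interval_integral_FTC_nonneg[of "0::ereal" "\<infinity>" ?F ?f, OF _ _ _ nn l0 lt]
  have "set_integrable lborel (einterval 0 \<infinity>) ?f"
    by (rule FTC(1)) (auto intro: Dv cont)
  moreover have "(LBINT x=0..\<infinity>. ?f x) = t * (pi / 2) - 0"
    by (rule FTC(2)) (auto intro: Dv cont)
  moreover have "einterval 0 \<infinity> = {0::real<..}" by (auto simp: einterval_def)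
  ultimately show ?thesis
    by (auto simp: has_bochner_integral_iff set_integrable_def interval_lebesgue_integral_def
        set_lebesgue_integral_def mult.commute)
qed

text \<open>Reflection doubles the half-line integral, and evenness in \<open>t\<close> produces the
  absolute value. At \<open>x = 0\<close> the integrand is 0 by division by zero, so the two
  half-line pieces add up to it everywhere.\<close>

lemma has_bochner_integral_one_minus_cos:
  "has_bochner_integral lborel (\<lambda>x. (1 - cos (t * x)) / x\<^sup>2) (pi * \<bar>t\<bar>)"
proof -
  have *: "has_bochner_integral lborel (\<lambda>x. (1 - cos (t * x)) / x\<^sup>2) (pi * t)" if t: "t > 0" for t :: real
  proof -
    note h = has_bochner_integral_one_minus_cos_pos[OF t]
    have h': "has_bochner_integral lborel (\<lambda>x. indicator {0<..} (- x) *\<^sub>R ((1 - cos (t * x)) / x\<^sup>2)) (pi * t / 2)"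
      using lborel_has_bochner_integral_real_affine_iff[of "-1" "\<lambda>x. indicator {0<..} x *\<^sub>R ((1 - cos (t * x)) / x\<^sup>2)" "pi * t / 2" 0] h
      by simp
    from has_bochner_integral_add[OF h h'] show ?thesis
    proof (rule has_bochner_integral_cong[THEN iffD1, rotated -1])
      fix x :: real
      show "indicator {0<..} x *\<^sub>R ((1 - cos (t * x)) / x\<^sup>2) + indicator {0<..} (- x) *\<^sub>R ((1 - cos (t * x)) / x\<^sup>2)
        = (1 - cos (t * x)) / x\<^sup>2"
        by (cases "x = 0"; cases "x > 0") (auto simp: indicator_def)
    qed auto
  qed
  consider "t > 0" | "t = 0" | "t < 0" by linarith
  thus ?thesis
  proof cases
    case 3
    thus ?thesis using *[of "-t"] by simp
  qed (use * in auto)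
qed

text \<open>Away from 0 this is the Fejer kernel, \<open>c\<close> times the square of
  \<open>sin (pi * c * \<alpha>) / (pi * c * \<alpha>)\<close>. Division by zero gives the value 0
  at the origin, which changes it on a null set only.\<close>

definition fejer_weight :: "real \<Rightarrow> real \<Rightarrow> real" where
  "fejer_weight c \<alpha> = (1 - cos (2 * pi * c * \<alpha>)) / (2 * pi\<^sup>2 * c * \<alpha>\<^sup>2)"

lemma fejer_weight_nonneg: "c > 0 \<Longrightarrow> fejer_weight c \<alpha> \<ge> 0"
  by (simp add: fejer_weight_def)

lemma borel_measurable_fejer_weight [measurable]: "fejer_weight c \<in> borel_measurable borel"
  unfolding fejer_weight_def by measurable

text \<open>Product-to-sum turns the integrand into a second difference, in the frequency, of the
  preceding integrals. The second difference of \<open>\<bar>y\<bar>\<close> with step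
  \<open>c\<close> is \<open>2 * c\<close> times the tent on [-c, c].\<close>

lemma has_bochner_integral_fejer_weight_cos:
  assumes c: "c > 0"
  shows "has_bochner_integral lborel (\<lambda>\<alpha>. fejer_weight c \<alpha> * cos (2 * pi * y * \<alpha>)) (max 0 (1 - \<bar>y\<bar> / c))"
proof -
  let ?g = "\<lambda>t x::real. (1 - cos (t * x)) / x\<^sup>2"
  let ?k = "1 / (4 * pi\<^sup>2 * c)"
  have cc: "2 * cos a * cos b = cos (a + b) + cos (a - b)" for a b :: real
    by (simp add: cos_add cos_diff)
  have "has_bochner_integral lborel (\<lambda>x. ?k * (?g (2 * pi * (y + c)) x + ?g (2 * pi * (y - c)) x - 2 * ?g (2 * pi * y) x))
     (?k * (pi * \<bar>2 * pi * (y + c)\<bar> + pi * \<bar>2 * pi * (y - c)\<bar> - 2 * (pi * \<bar>2 * pi * y\<bar>)))"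
    by (intro has_bochner_integral_mult_right has_bochner_integral_add has_bochner_integral_diff
        has_bochner_integral_one_minus_cos)
  moreover have "?k * (?g (2 * pi * (y + c)) x + ?g (2 * pi * (y - c)) x - 2 * ?g (2 * pi * y) x)
     = fejer_weight c x * cos (2 * pi * y * x)" for x
  proof (cases "x = 0")
    case False
    have eq: "2 * (1 - cos (2 * pi * c * x)) * cos (2 * pi * y * x) =
       (1 - cos (2 * pi * (y + c) * x)) + (1 - cos (2 * pi * (y - c) * x)) - 2 * (1 - cos (2 * pi * y * x))"
      using cc[of "2 * pi * y * x" "2 * pi * c * x"] by (simp add: algebra_simps)
    have "fejer_weight c x * cos (2 * pi * y * x) =
        2 * (1 - cos (2 * pi * c * x)) * cos (2 * pi * y * x) / (4 * pi\<^sup>2 * c * x\<^sup>2)"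
      using c False by (simp add: fejer_weight_def field_simps)
    thus ?thesis unfolding eq by (simp add: add_divide_distrib diff_divide_distrib distrib_left right_diff_distrib)
  qed (auto simp: fejer_weight_def)
  moreover have "?k * (pi * \<bar>2 * pi * (y + c)\<bar> + pi * \<bar>2 * pi * (y - c)\<bar> - 2 * (pi * \<bar>2 * pi * y\<bar>)) = max 0 (1 - \<bar>y\<bar> / c)"
  proof -
    have "?k * (pi * \<bar>2 * pi * (y + c)\<bar> + pi * \<bar>2 * pi * (y - c)\<bar> - 2 * (pi * \<bar>2 * pi * y\<bar>))
      = (\<bar>y + c\<bar> + \<bar>y - c\<bar> - 2 * \<bar>y\<bar>) / (2 * c)"
    proof -
      have a: "\<bar>2 * pi * u\<bar> = 2 * pi * \<bar>u\<bar>" for u by (simp add: abs_mult)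
      show ?thesis unfolding a using c by (simp add: field_simps power2_eq_square)
    qed
    also have "\<dots> = max 0 (1 - \<bar>y\<bar> / c)"
      using c by (auto simp: max_def abs_if field_simps)
    finally show ?thesis .
  qed
  ultimately show ?thesis by simp
qed

section \<open>Fourier series of trapezoidal functions\<close>

text \<open>This is the imaginary part of the power series of \<open>- Ln (1 - w)\<close> at
  \<open>w = r * cis x\<close>. The term \<open>k = 0\<close> vanishes because division by zero
  gives 0.\<close>

lemma sums_Abel_sin:
  fixes r x :: real
  assumes "0 \<le> r" "r < 1"
  shows "(\<lambda>k. r ^ k * sin (real k * x) / real k) sums - Im (Ln (1 - of_real r * cis x))"
proof -
  have "cmod (- (of_real r * cis x)) < 1" using assms by (simp add: norm_mult)
  from Ln_series'[OF this] have "(\<lambda>k. - ((of_real r * cis x) ^ k) / of_nat k) sums Ln (1 - of_real r * cis x)"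
    by simp
  from sums_minus[OF sums_Im[OF this]]
  show ?thesis
    by (simp add: power_mult_distrib Complex.DeMoivre flip: of_real_power)
qed

text \<open>\<open>1 - cis t\<close> has modulus \<open>2 * sin (t/2)\<close> and argument
  \<open>(t - pi) / 2\<close>, which lies in the principal range. Staying off the slit gives the
  continuity of \<open>Ln\<close> needed when \<open>r\<close> tends to 1.\<close>

lemma Im_Ln_one_minus_cis:
  fixes t :: real
  assumes "0 < t" "t < 2 * pi"
  shows "1 - cis t \<notin> \<real>\<^sub>\<le>\<^sub>0" "Im (Ln (1 - cis t)) = (t - pi) / 2"
proof -
  have s: "sin (t/2) > 0" using assms by (intro sin_gt_zero) auto
  have eq: "1 - cis t = of_real (2 * sin (t/2)) * cis ((t - pi) / 2)"
  proof (rule complex_eqI)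
    have "cos t = 1 - 2 * sin (t/2)^2" using cos_double_sin[of "t/2"] by simp
    moreover have "cos ((t - pi)/2) = sin (t/2)" by (simp add: cos_diff diff_divide_distrib)
    ultimately show "Re (1 - cis t) = Re (of_real (2 * sin (t/2)) * cis ((t - pi) / 2))"
      by (simp add: power2_eq_square)
    have "sin t = 2 * sin (t/2) * cos (t/2)" using sin_double[of "t/2"] by simp
    moreover have "sin ((t - pi)/2) = - cos (t/2)" by (simp add: sin_diff diff_divide_distrib)
    ultimately show "Im (1 - cis t) = Im (of_real (2 * sin (t/2)) * cis ((t - pi) / 2))" by simp
  qed
  have "Re (1 - cis t) > 0"
    using s cos_double_sin[of "t/2"] by simp
  thus "1 - cis t \<notin> \<real>\<^sub>\<le>\<^sub>0" by (auto simp: complex_nonpos_Reals_iff)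
  have e2: "1 - cis t = exp (of_real (ln (2 * sin (t/2))) + \<i> * of_real ((t - pi) / 2))"
    unfolding eq exp_add using s by (simp only: cis_conv_exp exp_of_real exp_ln mult_pos_pos zero_less_numeral)
  have "Ln (1 - cis t) = of_real (ln (2 * sin (t/2))) + \<i> * of_real ((t - pi) / 2)"
    unfolding e2 using assms by (intro Ln_exp) (auto simp: field_simps)
  thus "Im (Ln (1 - cis t)) = (t - pi) / 2" by simp
qed

text \<open>Abel summation makes termwise integration legitimate; the limit \<open>r \<rightarrow> 1\<close> is taken below
  by dominated convergence, since \<open>Im (Ln z)\<close> is bounded by \<open>pi\<close>.\<close>

lemma integral_Abel_one_minus_cos:
  fixes r x :: real
  assumes r: "0 \<le> r" "r < 1" and x: "0 \<le> x"
  shows "((\<lambda>t. - Im (Ln (1 - of_real r * cis t))) has_integral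
     (\<Sum>k. r ^ k * (1 - cos (real k * x)) / (real k)\<^sup>2)) {0..x}"
proof -
  let ?u = "\<lambda>x. \<Sum>k. r ^ k * (1 - cos (real k * x)) / (real k)\<^sup>2"
  have sr: "summable (\<lambda>k. r ^ k)" using r by (simp add: summable_geometric)
  have D0: "(?u has_field_derivative (\<Sum>k. r ^ k * sin (real k * y) / real k)) (at y)" for y
  proof (rule has_field_derivative_series'(2)[where S = UNIV and ?x0.0 = 0 and
        f = "\<lambda>k x. r ^ k * (1 - cos (real k * x)) / (real k)\<^sup>2" and
        f' = "\<lambda>n y. r ^ n * sin (real n * y) / real n"])
    fix n y
    show "((\<lambda>x. r ^ n * (1 - cos (real n * x)) / (real n)\<^sup>2) has_field_derivative
        r ^ n * sin (real n * y) / real n) (at y within UNIV)"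
      by (cases "n = 0") (auto intro!: derivative_eq_intros simp: field_simps power2_eq_square)
  next
    \<comment> \<open>The Abel factor \<open>r ^ n\<close> supplies the majorant that permits
      termwise differentiation.\<close>
    show "uniformly_convergent_on UNIV (\<lambda>n x. \<Sum>i<n. r ^ i * sin (real i * x) / real i)"
    proof (rule Weierstrass_m_test'[OF _ sr])
      fix n :: nat and x :: real
      show "norm (r ^ n * sin (real n * x) / real n) \<le> r ^ n"
      proof (cases "n = 0")
        case False
        have "\<bar>sin (real n * x)\<bar> \<le> real n" using False abs_sin_le_one[of "real n * x"] by linarith
        thus ?thesis using r False by (auto simp: abs_mult divide_simps mult_left_mono)
      qed (use r in auto)
    qed
  qed auto
  have D: "(?u has_field_derivative - Im (Ln (1 - of_real r * cis y))) (at y)" for y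
    using D0[of y] by (simp only: sums_unique[OF sums_Abel_sin[OF r, of y], symmetric])
  have "((\<lambda>t. - Im (Ln (1 - of_real r * cis t))) has_integral (?u x - ?u 0)) {0..x}"
    using D x by (intro fundamental_theorem_of_calculus)
      (auto simp: has_real_derivative_iff_has_vector_derivative[symmetric] intro: has_field_derivative_at_within)
  thus ?thesis by simp
qed

text \<open>The limit of the Abel identity is computed on both sides: by Tannery's theorem for the
  series, and by dominated convergence for the integral, which tends to the integral of
  \<open>(pi - t) / 2\<close> over [0, x].\<close>

lemma sums_one_minus_cos_over_square:
  fixes x :: real
  assumes x: "0 \<le> x" "x \<le> 2 * pi"
  shows "(\<lambda>k. (1 - cos (real k * x)) / (real k)\<^sup>2) sums (pi * x / 2 - x\<^sup>2 / 4)"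
proof -
  let ?r = "\<lambda>n. 1 - 1 / real (Suc n)"
  let ?f = "\<lambda>n t. - Im (Ln (1 - of_real (?r n) * cis t))"
  let ?a = "\<lambda>k n. ?r n ^ k * (1 - cos (real k * x)) / (real k)\<^sup>2"
  let ?b = "\<lambda>k. (1 - cos (real k * x)) / (real k)\<^sup>2"
  have r: "0 \<le> ?r n" "?r n < 1" for n by auto
  have rl: "?r \<longlonglongrightarrow> 1" by real_asymp
  have bd: "\<bar>1 - cos y\<bar> \<le> 2" for y :: real using cos_ge_minus_one[of y] cos_le_one[of y] by linarith
  have "eventually (\<lambda>n. summable (\<lambda>k. norm (?a k n))) sequentially \<and>
     summable (\<lambda>n. norm (?b n)) \<and> ((\<lambda>n. suminf (\<lambda>k. ?a k n)) \<longlonglongrightarrow> suminf ?b)"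
  proof (rule tannerys_theorem)
    fix k show "(\<lambda>n. ?a k n) \<longlonglongrightarrow> ?b k"
      using tendsto_mult[OF tendsto_power[OF rl, of k] tendsto_const, of "(1 - cos (real k * x)) / (real k)\<^sup>2"]
      by simp
  next
    have "norm (?a k n) \<le> 2 * (1 / (real k)\<^sup>2)" for k n
    proof -
      have "\<bar>?r n ^ k\<bar> * \<bar>1 - cos (real k * x)\<bar> \<le> 1 * 2"
        using r[of n] by (intro mult_mono bd) (auto simp: power_le_one simp del: of_nat_Suc)
      thus ?thesis by (simp add: abs_mult divide_right_mono del: of_nat_Suc)
    qed
    thus "eventually (\<lambda>(k,n). norm (?a k n) \<le> 2 * (1 / (real k)\<^sup>2)) (at_top \<times>\<^sub>F sequentially)"
      by (intro always_eventually) auto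
    show "summable (\<lambda>k. 2 * (1 / (real k)\<^sup>2))"
      using inverse_power_summable[of 2, where 'a = real] by (intro summable_mult) (simp add: inverse_eq_divide)
  qed auto
  hence sb: "summable ?b" and L1: "(\<lambda>n. suminf (\<lambda>k. ?a k n)) \<longlonglongrightarrow> suminf ?b"
    by (auto dest: summable_norm_cancel)
  have hi: "(?f n has_integral (\<Sum>k. ?a k n)) {0..x}" for n
    using integral_Abel_one_minus_cos[OF r x(1)] .
  \<comment> \<open>The endpoints are discarded: at \<open>t = 0\<close> and at
    \<open>t = 2 * pi\<close> the integrands are 0 for every \<open>n\<close> and do not tend to
    \<open>(pi - t) / 2\<close>.\<close>
  have hi': "(?f n has_integral (\<Sum>k. ?a k n)) {0<..<x}" for n
    using hi[of n] by (simp add: has_integral_Icc_iff_Ioo)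
  have lim: "(\<lambda>n. ?f n t) \<longlonglongrightarrow> (pi - t) / 2" if t: "t \<in> {0<..<x}" for t
  proof -
    have t2: "0 < t" "t < 2 * pi" using t x by auto
    have "(\<lambda>n. 1 - of_real (?r n) * cis t) \<longlonglongrightarrow> 1 - of_real 1 * cis t"
      by (intro tendsto_intros rl)
    hence "(\<lambda>n. Ln (1 - of_real (?r n) * cis t)) \<longlonglongrightarrow> Ln (1 - cis t)"
      using Im_Ln_one_minus_cis(1)[OF t2] by (intro tendsto_Ln) auto
    from tendsto_minus[OF tendsto_Im[OF this]] show ?thesis
      unfolding Im_Ln_one_minus_cis(2)[OF t2] by (simp add: minus_divide_left)
  qed
  have bdd: "norm (?f n t) \<le> pi" for n t
  proof -
    have "1 - of_real (?r n) * cis t \<noteq> 0"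
    proof
      assume "1 - of_real (?r n) * cis t = 0"
      hence "of_real (?r n) * cis t = 1" by (metis eq_iff_diff_eq_0)
      hence "\<bar>?r n\<bar> = 1" by (metis norm_mult norm_of_real norm_cis mult_1_right norm_one)
      thus False using r[of n] by linarith
    qed
    from mpi_less_Im_Ln[OF this] Im_Ln_le_pi[OF this] show ?thesis by auto
  qed
  have "(\<lambda>_. pi) integrable_on {0..x}" by (rule integrable_const_ivl)
  hence ci: "(\<lambda>_. pi) integrable_on {0<..<x}" unfolding integrable_on_def has_integral_Icc_iff_Ioo .
  have "(\<lambda>n. integral {0<..<x} (?f n)) \<longlonglongrightarrow> integral {0<..<x} (\<lambda>t. (pi - t) / 2)"
    by (rule dominated_convergence(2)[where h = "\<lambda>_. pi"])
       (use hi' bdd lim ci in \<open>auto intro: has_integral_integrable\<close>)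
  hence L2: "(\<lambda>n. suminf (\<lambda>k. ?a k n)) \<longlonglongrightarrow> integral {0<..<x} (\<lambda>t. (pi - t) / 2)"
    by (simp only: integral_unique[OF hi'])
  have "((\<lambda>t. (pi - t) / 2) has_integral ((pi * x / 2 - x\<^sup>2 / 4) - (pi * 0 / 2 - 0\<^sup>2 / 4))) {0..x}"
    using x by (intro fundamental_theorem_of_calculus)
      (auto simp: has_real_derivative_iff_has_vector_derivative[symmetric] field_simps intro!: derivative_eq_intros)
  hence "integral {0<..<x} (\<lambda>t. (pi - t) / 2) = pi * x / 2 - x\<^sup>2 / 4"
    by (intro integral_unique) (simp add: has_integral_Icc_iff_Ioo)
  with LIMSEQ_unique[OF L1 L2] sb show ?thesis by (simp add: sums_iff)
qed

section \<open>The periodic parabola, 1/6 minus the periodised second Bernoulli polynomial, and its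
  Fourier series\<close>

definition periodic_parabola :: "real \<Rightarrow> real" where
  "periodic_parabola u = frac u - (frac u)\<^sup>2"

lemma periodic_parabola_add_of_int [simp]: "periodic_parabola (u + of_int k) = periodic_parabola u"
  by (simp add: periodic_parabola_def frac_def)

lemma borel_measurable_periodic_parabola [measurable]: "periodic_parabola \<in> borel_measurable borel"
  unfolding periodic_parabola_def frac_def by measurable

text \<open>\<open>frac u\<close> is \<open>u\<close> on [0, 1) and \<open>u + 1\<close> on [-1, 0).
  Having one formula on both sides of 0 is what lets the quadratic parts cancel in
  \<open>trapezoid_eq\<close>.\<close>

lemma periodic_parabola_eq:
  assumes "\<bar>u\<bar> \<le> 1"
  shows "periodic_parabola u = \<bar>u\<bar> - u\<^sup>2"
proof -
  consider "0 \<le> u" "u < 1" | "u = 1" | "-1 \<le> u" "u < 0" using assms by linarith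
  thus ?thesis
  proof cases
    case 1
    thus ?thesis by (simp add: periodic_parabola_def frac_eq[THEN iffD2])
  next
    case 3
    hence "frac u = u + 1" by (simp add: frac_unique_iff)
    thus ?thesis using 3 by (simp add: periodic_parabola_def power2_eq_square algebra_simps)
  qed (auto simp: periodic_parabola_def)
qed

lemma cos_two_pi_frac: "cos (2 * pi * real k * frac u) = cos (2 * pi * real k * u)"
proof -
  have "2 * pi * real k * frac u = 2 * pi * real k * u - of_int (int k * \<lfloor>u\<rfloor>) * (2 * pi)"
    by (simp add: frac_def algebra_simps)
  thus ?thesis by (simp add: cos_diff mult.commute[of _ "2 * pi"] del: of_int_mult)
qed

lemma periodic_parabola_sums:
  "(\<lambda>k. (1 - cos (2 * pi * real k * u)) / (pi\<^sup>2 * (real k)\<^sup>2)) sums periodic_parabola u"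
proof -
  let ?x = "2 * pi * frac u"
  have "(\<lambda>k. (1 - cos (real k * ?x)) / (real k)\<^sup>2) sums (pi * ?x / 2 - ?x\<^sup>2 / 4)"
    by (rule sums_one_minus_cos_over_square) (auto simp: frac_lt_1 less_imp_le)
  from sums_divide[OF this, of "pi\<^sup>2"]
  have "(\<lambda>k. (1 - cos (real k * ?x)) / (real k)\<^sup>2 / pi\<^sup>2) sums ((pi * ?x / 2 - ?x\<^sup>2 / 4) / pi\<^sup>2)" .
  moreover have "(pi * ?x / 2 - ?x\<^sup>2 / 4) / pi\<^sup>2 = periodic_parabola u"
    by (simp add: periodic_parabola_def field_simps power2_eq_square)
  moreover have "cos (real k * ?x) = cos (2 * pi * real k * u)" for k
    using cos_two_pi_frac[of k u] by (simp add: mult_ac)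
  ultimately show ?thesis by (simp add: mult.commute)
qed

text \<open>The second derivative of \<open>periodic_parabola\<close> is a constant plus a point mass at each integer, so
  this combination is piecewise linear with breakpoints at \<open>\<plusminus>a\<close> and \<open>\<plusminus>b\<close>.\<close>

definition trapezoid :: "real \<Rightarrow> real \<Rightarrow> real \<Rightarrow> real" where
  "trapezoid a b \<theta> = (a + b) + (periodic_parabola (\<theta> + b) + periodic_parabola (\<theta> - b)
     - periodic_parabola (\<theta> + a) - periodic_parabola (\<theta> - a)) / (2 * (b - a))"

text \<open>The cosine coefficients for \<open>k > 0\<close>. Division by zero makes the coefficient
  at \<open>k = 0\<close> vanish, so the mean \<open>a + b\<close> is always written
  separately.\<close>

definition trapezoid_coeff :: "real \<Rightarrow> real \<Rightarrow> nat \<Rightarrow> real" where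
  "trapezoid_coeff a b k = (cos (2 * pi * real k * a) - cos (2 * pi * real k * b)) / ((b - a) * pi\<^sup>2 * (real k)\<^sup>2)"

lemma borel_measurable_trapezoid [measurable]: "trapezoid a b \<in> borel_measurable borel"
  unfolding trapezoid_def by measurable

lemma trapezoid_add_of_int [simp]: "trapezoid a b (\<theta> + of_int k) = trapezoid a b \<theta>"
proof -
  have "periodic_parabola (\<theta> + of_int k + c) = periodic_parabola (\<theta> + c)" for c
    using periodic_parabola_add_of_int[of "\<theta> + c" k] by (simp add: add_ac)
  from this[of a] this[of b] this[of "- a"] this[of "- b"] show ?thesis by (simp add: trapezoid_def)
qed

text \<open>The four squares together contribute \<open>- (a + b)\<close> and cancel the constant in
  \<open>trapezoid\<close>. The hypotheses keep all four shifted arguments in [-1, 1].\<close>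

lemma trapezoid_eq:
  assumes "0 < a" "a < b" "b < 1/2" "\<bar>\<theta>\<bar> \<le> 1/2"
  shows "trapezoid a b \<theta> = (\<bar>\<theta> + b\<bar> + \<bar>\<theta> - b\<bar> - \<bar>\<theta> + a\<bar> - \<bar>\<theta> - a\<bar>) / (2 * (b - a))"
proof -
  have "\<bar>\<theta> + b\<bar> \<le> 1" "\<bar>\<theta> - b\<bar> \<le> 1" "\<bar>\<theta> + a\<bar> \<le> 1" "\<bar>\<theta> - a\<bar> \<le> 1" using assms by auto
  note eqs = this[THEN periodic_parabola_eq]
  show ?thesis unfolding trapezoid_def eqs using assms
    by (simp add: field_simps power2_eq_square)
qed

lemma ex_int_near: "\<exists>k::int. \<bar>\<theta> + of_int k\<bar> \<le> 1/2" for \<theta> :: real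
  by (rule exI[of _ "- round \<theta>"]) (use of_int_round_abs_le[of \<theta>] in \<open>simp add: abs_minus_commute\<close>)

lemma trapezoid_bounds:
  assumes ab: "0 < a" "a < b" "b < 1/2"
  shows "0 \<le> trapezoid a b \<theta>" "trapezoid a b \<theta> \<le> 1"
proof -
  obtain k :: int where "\<bar>\<theta> + of_int k\<bar> \<le> 1/2" using ex_int_near by blast
  from trapezoid_eq[OF ab this] have eq: "trapezoid a b \<theta> =
    (\<bar>\<theta> + of_int k + b\<bar> + \<bar>\<theta> + of_int k - b\<bar> - \<bar>\<theta> + of_int k + a\<bar> - \<bar>\<theta> + of_int k - a\<bar>) / (2 * (b - a))"
    by simp
  show "0 \<le> trapezoid a b \<theta>" "trapezoid a b \<theta> \<le> 1" unfolding eq using ab by (auto simp: divide_simps)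
qed

lemma trapezoid_eq_1:
  assumes ab: "0 < a" "a < b" "b < 1/2" and "\<bar>\<theta> + of_int k\<bar> \<le> a"
  shows "trapezoid a b \<theta> = 1"
proof -
  have "trapezoid a b (\<theta> + of_int k) = 1"
    using assms by (subst trapezoid_eq) (auto simp: divide_simps)
  thus ?thesis by simp
qed

lemma trapezoid_pos_imp:
  assumes ab: "0 < a" "a < b" "b < 1/2" and "0 < trapezoid a b \<theta>"
  shows "\<exists>k::int. \<bar>\<theta> + of_int k\<bar> \<le> b"
proof -
  obtain k :: int where k: "\<bar>\<theta> + of_int k\<bar> \<le> 1/2" using ex_int_near by blast
  from trapezoid_eq[OF ab this] have eq: "trapezoid a b \<theta> =
    (\<bar>\<theta> + of_int k + b\<bar> + \<bar>\<theta> + of_int k - b\<bar> - \<bar>\<theta> + of_int k + a\<bar> - \<bar>\<theta> + of_int k - a\<bar>) / (2 * (b - a))"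
    by simp
  have "\<bar>\<theta> + of_int k\<bar> \<le> b"
    using assms(4) ab unfolding eq by (auto simp: zero_less_divide_iff)
  thus ?thesis by blast
qed

text \<open>Four shifted series of \<open>periodic_parabola\<close> are superposed: the constants
  cancel, and each pair of opposite shifts gives twice a product of cosines.\<close>

lemma trapezoid_sums:
  assumes "a < b"
  shows "(\<lambda>k. trapezoid_coeff a b k * cos (2 * pi * real k * \<theta>)) sums (trapezoid a b \<theta> - (a + b))"
proof -
  let ?c = "\<lambda>k u. (1 - cos (2 * pi * real k * u)) / (pi\<^sup>2 * (real k)\<^sup>2)"
  have "(\<lambda>k. (?c k (\<theta> + b) + ?c k (\<theta> - b) - ?c k (\<theta> + a) - ?c k (\<theta> - a)) / (2 * (b - a)))
     sums (trapezoid a b \<theta> - (a + b))"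
    unfolding trapezoid_def add_diff_cancel_left'
    by (intro sums_divide sums_diff sums_add periodic_parabola_sums)
  moreover have "(?c k (\<theta> + b) + ?c k (\<theta> - b) - ?c k (\<theta> + a) - ?c k (\<theta> - a)) / (2 * (b - a))
     = trapezoid_coeff a b k * cos (2 * pi * real k * \<theta>)" for k
  proof -
    have "cos (2 * pi * real k * (\<theta> + u)) + cos (2 * pi * real k * (\<theta> - u)) =
       2 * cos (2 * pi * real k * \<theta>) * cos (2 * pi * real k * u)" for u
      by (simp add: distrib_left right_diff_distrib cos_add cos_diff)
    from this[of a] this[of b]
    have "(1 - cos (2 * pi * real k * (\<theta> + b))) + (1 - cos (2 * pi * real k * (\<theta> - b)))
       - (1 - cos (2 * pi * real k * (\<theta> + a))) - (1 - cos (2 * pi * real k * (\<theta> - a)))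
       = 2 * (cos (2 * pi * real k * a) - cos (2 * pi * real k * b)) * cos (2 * pi * real k * \<theta>)"
      by (simp add: algebra_simps)
    hence eq: "?c k (\<theta> + b) + ?c k (\<theta> - b) - ?c k (\<theta> + a) - ?c k (\<theta> - a)
       = 2 * (cos (2 * pi * real k * a) - cos (2 * pi * real k * b)) * cos (2 * pi * real k * \<theta>) / (pi\<^sup>2 * (real k)\<^sup>2)"
      by (simp add: add_divide_distrib[symmetric] diff_divide_distrib[symmetric])
    have "2 * X * Y / P / (2 * D) = X / (D * P) * Y" for X Y P D :: real by (simp add: mult_ac)
    thus ?thesis unfolding eq trapezoid_coeff_def by (simp only: mult.assoc)
  qed
  ultimately show ?thesis by simp
qed

text \<open>The first bound, from writing the numerator as a product of sines, serves frequencies up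
  to about \<open>1 / (a + b)\<close>. The second bounds the numerator by 2 and gives summable
  decay.\<close>

lemma trapezoid_coeff_bounds:
  assumes "0 < a" "a < b"
  shows "\<bar>trapezoid_coeff a b k\<bar> \<le> 2 * (a + b)"
    and "\<bar>trapezoid_coeff a b k\<bar> \<le> 1 / (b - a) / (real k)\<^sup>2"
proof -
  let ?n = "cos (2 * pi * real k * a) - cos (2 * pi * real k * b)"
  have eq: "\<bar>trapezoid_coeff a b k\<bar> = \<bar>?n\<bar> / ((b - a) * pi\<^sup>2 * (real k)\<^sup>2)"
    using assms by (simp add: trapezoid_coeff_def abs_mult)
  have "?n = 2 * sin (pi * k * (a + b)) * sin (pi * k * (b - a))"
  proof -
    have "(2 * pi * real k * a + 2 * pi * real k * b) / 2 = pi * k * (a + b)"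
      "(2 * pi * real k * b - 2 * pi * real k * a) / 2 = pi * k * (b - a)" by (simp_all add: field_simps)
    thus ?thesis by (simp only: cos_diff_cos)
  qed
  hence "\<bar>?n\<bar> = 2 * \<bar>sin (pi * k * (a + b))\<bar> * \<bar>sin (pi * k * (b - a))\<bar>" by (simp add: abs_mult)
  also have "\<dots> \<le> 2 * \<bar>pi * k * (a + b)\<bar> * \<bar>pi * k * (b - a)\<bar>"
    by (intro mult_mono abs_sin_x_le_abs_x) auto
  finally have n1: "\<bar>?n\<bar> \<le> 2 * (a + b) * ((b - a) * pi\<^sup>2 * (real k)\<^sup>2)"
    using assms by (simp add: abs_mult power2_eq_square mult_ac)
  show "\<bar>trapezoid_coeff a b k\<bar> \<le> 2 * (a + b)"
  proof (cases "k = 0")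
    case False
    thus ?thesis unfolding eq using n1 assms by (simp add: pos_divide_le_eq)
  qed (use assms in \<open>simp add: trapezoid_coeff_def\<close>)
  have "\<bar>?n\<bar> \<le> 2" using cos_ge_minus_one[of "2 * pi * real k * a"] cos_le_one[of "2 * pi * real k * a"]
     cos_ge_minus_one[of "2 * pi * real k * b"] cos_le_one[of "2 * pi * real k * b"] by linarith
  also have "2 \<le> pi\<^sup>2" using pi_gt3 power_mono[of 3 pi 2] by simp
  finally have n2: "\<bar>?n\<bar> \<le> pi\<^sup>2" .
  have "\<bar>trapezoid_coeff a b k\<bar> \<le> pi\<^sup>2 / ((b - a) * pi\<^sup>2 * (real k)\<^sup>2)"
    unfolding eq by (rule divide_right_mono[OF n2]) (use assms in auto)
  thus "\<bar>trapezoid_coeff a b k\<bar> \<le> 1 / (b - a) / (real k)\<^sup>2"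
    using assms by simp
qed

lemma trapezoid_coeff_summable:
  assumes "0 < a" "a < b"
  shows "summable (\<lambda>k. \<bar>trapezoid_coeff a b k\<bar>)"
proof (rule summable_comparison_test')
  show "summable (\<lambda>k. 1 / (b - a) / (real k)\<^sup>2)"
    using summable_mult[OF inverse_power_summable[of 2, where 'a = real], of "1 / (b - a)"]
    by (simp add: inverse_eq_divide)
qed (use trapezoid_coeff_bounds(2)[OF assms] in auto)

text \<open>The series is split near \<open>1 / (a + b)\<close>. The head is at most 6, hence at
  most \<open>6 * (a + b) / (b - a)\<close>, and the tail is at most
  \<open>(a + b) / (b - a)\<close>. The bound is invariant under scaling of \<open>a\<close> and
  \<open>b\<close>, so it does not depend on the number of points later.\<close>

lemma trapezoid_coeff_suminf_le:
  assumes ab: "0 < a" "a < b" "b < 1/2"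
  shows "(\<Sum>k. \<bar>trapezoid_coeff a b k\<bar>) \<le> 7 * (a + b) / (b - a)"
proof -
  let ?c = "\<lambda>k. \<bar>trapezoid_coeff a b k\<bar>"
  define h where "h = a + b"
  define K where "K = nat \<lceil>1 / h\<rceil>"
  have h: "0 < h" "h < 1" using ab by (auto simp: h_def)
  have K1: "1 / h \<le> real K" unfolding K_def by linarith
  have K2: "real K \<le> 1 / h + 1" using h unfolding K_def by (simp add: of_nat_nat)
  have K0: "0 < real K" using K1 h by (meson divide_pos_pos less_le_trans zero_less_one)
  note sm = trapezoid_coeff_summable[OF ab(1,2)]
  \<comment> \<open>Telescoping majorant for the tail: the square of \<open>n + K + 1\<close> is
    replaced by the product of \<open>n + K\<close> and \<open>n + K + 1\<close>.\<close>
  have tele: "(\<lambda>n. 1 / (real n + real K) - 1 / (real (Suc n) + real K)) sums (1 / (real 0 + real K) - 0)"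
    by (rule telescope_sums') real_asymp
  have "(\<Sum>k. ?c (k + Suc K)) \<le> (\<Sum>n. 1 / (b - a) * (1 / (real n + real K) - 1 / (real (Suc n) + real K)))"
  proof (rule suminf_le)
    fix n
    have "1 / (real (n + Suc K))\<^sup>2 \<le> 1 / ((real n + real K) * (real (Suc n) + real K))"
      using K0 by (intro divide_left_mono) (auto simp: power2_eq_square intro!: mult_mono mult_pos_pos)
    also have "\<dots> = 1 / (real n + real K) - 1 / (real (Suc n) + real K)"
      using K0 by (simp add: divide_simps)
    finally have "1 / (b - a) * (1 / (real (n + Suc K))\<^sup>2) \<le> 1 / (b - a) * (1 / (real n + real K) - 1 / (real (Suc n) + real K))"
      using ab by (intro mult_left_mono) auto
    with trapezoid_coeff_bounds(2)[OF ab(1,2), of "n + Suc K"]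
    show "?c (n + Suc K) \<le> 1 / (b - a) * (1 / (real n + real K) - 1 / (real (Suc n) + real K))" by simp
  next
    show "summable (\<lambda>k. ?c (k + Suc K))" using sm by (subst summable_iff_shift)
    show "summable (\<lambda>n. 1 / (b - a) * (1 / (real n + real K) - 1 / (real (Suc n) + real K)))"
      by (intro summable_mult sums_summable[OF tele])
  qed
  also have "\<dots> = 1 / (b - a) * (1 / real K)"
    using sums_unique[OF sums_mult[OF tele, of "1 / (b - a)"]] by simp
  also have "\<dots> \<le> 1 / (b - a) * h"
    using K1 K0 h ab by (intro mult_left_mono) (auto simp: field_simps)
  finally have t: "(\<Sum>k. ?c (k + Suc K)) \<le> h / (b - a)" by simp
  have "(\<Sum>k<Suc K. ?c k) \<le> real (card {..<Suc K}) * (2 * h)"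
    by (rule sum_bounded_above) (use trapezoid_coeff_bounds(1)[OF ab(1,2)] in \<open>auto simp: h_def\<close>)
  also have "\<dots> = 2 * (real K + 1) * h" by simp
  also have "\<dots> \<le> 2 * (1 / h + 1 + 1) * h" using K2 h by (intro mult_right_mono) auto
  also have "\<dots> = 2 + 4 * h" using h by (simp add: field_simps)
  also have "\<dots> \<le> 6 * 1" using h by simp
  also have "\<dots> \<le> 6 * (h / (b - a))" using ab by (intro mult_left_mono) (auto simp: h_def)
  finally have "(\<Sum>k<Suc K. ?c k) \<le> 6 * (h / (b - a))" .
  moreover have "7 * h / (b - a) = h / (b - a) + 6 * (h / (b - a))" by simp
  ultimately show ?thesis
    using t suminf_split_initial_segment[OF sm, of "Suc K"] unfolding h_def by linarith
qed

section \<open>Correlations in dimension one\<close>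

definition fejer_measure :: "real \<Rightarrow> real measure" where
  "fejer_measure c = density lborel (\<lambda>\<alpha>. ennreal (fejer_weight c \<alpha>))"

lemma sets_fejer_measure [measurable_cong, simp]: "sets (fejer_measure c) = sets borel"
  by (simp add: fejer_measure_def)

lemma space_fejer_measure [simp]: "space (fejer_measure c) = UNIV"
  by (simp add: fejer_measure_def)

definition tent :: "real \<Rightarrow> real \<Rightarrow> real" where
  "tent c y = max 0 (1 - \<bar>y\<bar> / c)"

lemma tent_bounds: "c > 0 \<Longrightarrow> 0 \<le> tent c y" "c > 0 \<Longrightarrow> tent c y \<le> 1"
  by (auto simp: tent_def)

lemma tent_eq_0: "c > 0 \<Longrightarrow> \<bar>y\<bar> \<ge> c \<Longrightarrow> tent c y = 0"
  by (simp add: tent_def max_def)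

lemma fejer_measure_cos:
  assumes c: "c > 0"
  shows "integrable (fejer_measure c) (\<lambda>\<alpha>. cos (2 * pi * y * \<alpha>))"
    and "(\<integral>\<alpha>. cos (2 * pi * y * \<alpha>) \<partial>fejer_measure c) = tent c y"
  using has_bochner_integral_fejer_weight_cos[OF c, of y] fejer_weight_nonneg[OF c]
  by (auto simp: fejer_measure_def has_bochner_integral_iff integrable_density integral_density tent_def)

lemma prob_space_fejer_measure:
  assumes c: "c > 0"
  shows "prob_space (fejer_measure c)"
proof
  have h: "has_bochner_integral lborel (fejer_weight c) 1"
    using has_bochner_integral_fejer_weight_cos[OF c, of 0] by simp
  have "(\<integral>\<^sup>+\<alpha>. ennreal (fejer_weight c \<alpha>) \<partial>lborel) = ennreal 1"
    using h fejer_weight_nonneg[OF c] nn_integral_eq_integral[of lborel "fejer_weight c"]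
    by (auto simp: has_bochner_integral_iff)
  thus "emeasure (fejer_measure c) (space (fejer_measure c)) = 1"
    by (simp add: fejer_measure_def emeasure_density)
qed

lemma fejer_measure_cos_cos:
  assumes c: "c > 0"
  shows "(\<integral>\<alpha>. cos (2 * pi * u * \<alpha>) * cos (2 * pi * v * \<alpha>) \<partial>fejer_measure c) = (tent c (u - v) + tent c (u + v)) / 2"
proof -
  have eq: "cos (2 * pi * u * \<alpha>) * cos (2 * pi * v * \<alpha>) =
      (cos (2 * pi * (u - v) * \<alpha>) + cos (2 * pi * (u + v) * \<alpha>)) / 2" for \<alpha>
    by (simp add: left_diff_distrib right_diff_distrib distrib_left distrib_right cos_add cos_diff)
  show ?thesis unfolding eq
    by (simp add: fejer_measure_cos[OF c])
qed

text \<open>Termwise integration is legitimate because the coefficients are absolutely summable, the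
  other factors are bounded by 1 and the measure has mass 1. The test function \<open>g\<close> is
  taken below as 1, as a cosine and as a second trapezoid.\<close>

lemma trapezoid_integral_sums:
  assumes c: "c > 0" and ab: "0 < a" "a < b" "b < 1/2"
    and g [measurable]: "g \<in> borel_measurable borel" and g1: "\<And>\<alpha>. \<bar>g \<alpha>\<bar> \<le> 1"
  shows "(\<lambda>k. trapezoid_coeff a b k * (\<integral>\<alpha>. cos (2 * pi * (real k * z) * \<alpha>) * g \<alpha> \<partial>fejer_measure c)) sums
     ((\<integral>\<alpha>. trapezoid a b (z * \<alpha>) * g \<alpha> \<partial>fejer_measure c) - (a + b) * (\<integral>\<alpha>. g \<alpha> \<partial>fejer_measure c))"
proof -
  interpret prob_space "fejer_measure c" by (rule prob_space_fejer_measure[OF c])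
  let ?M = "fejer_measure c"
  have b1: "integrable ?M f" if "f \<in> borel_measurable borel" "\<And>\<alpha>. \<bar>f \<alpha>\<bar> \<le> B" for f :: "real \<Rightarrow> real" and B
    using that by (intro integrable_const_bound[where B = B]) auto
  have gi: "integrable ?M g" by (rule b1[OF g g1])
  have Tg: "integrable ?M (\<lambda>\<alpha>. trapezoid a b (z * \<alpha>) * g \<alpha>)"
    by (rule b1[of _ 1]) (use trapezoid_bounds[OF ab] g1 in \<open>auto simp: abs_mult intro!: mult_le_one\<close>)
  let ?f = "\<lambda>k \<alpha>. trapezoid_coeff a b k * (cos (2 * pi * (real k * z) * \<alpha>) * g \<alpha>)"
  have cg: "\<bar>cos (2 * pi * (real k * z) * \<alpha>) * g \<alpha>\<bar> \<le> 1" for k \<alpha>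
    using g1 by (auto simp: abs_mult intro!: mult_le_one)
  have fb: "norm (?f k \<alpha>) \<le> \<bar>trapezoid_coeff a b k\<bar>" for k \<alpha>
    using mult_left_mono[OF cg[of k \<alpha>], of "\<bar>trapezoid_coeff a b k\<bar>"] by (simp add: abs_mult)
  have fi: "integrable ?M (?f k)" for k
    by (rule b1[of _ "\<bar>trapezoid_coeff a b k\<bar>"]) (use fb in auto)
  note sm = trapezoid_coeff_summable[OF ab(1,2)]
  have s1: "AE \<alpha> in ?M. summable (\<lambda>k. norm (?f k \<alpha>))"
    by (intro AE_I2 summable_comparison_test'[OF sm]) (use fb in auto)
  have "(\<integral>\<alpha>. norm (?f k \<alpha>) \<partial>?M) \<le> \<bar>trapezoid_coeff a b k\<bar>" for k
    by (intro integral_le_const integrable_norm fi AE_I2 fb)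
  hence s2: "summable (\<lambda>k. \<integral>\<alpha>. norm (?f k \<alpha>) \<partial>?M)"
    by (intro summable_comparison_test'[OF sm]) auto
  have "(\<lambda>k. ?f k \<alpha>) sums (trapezoid a b (z * \<alpha>) * g \<alpha> - (a + b) * g \<alpha>)" for \<alpha>
    using sums_mult2[OF trapezoid_sums[OF ab(2), of "z * \<alpha>"], of "g \<alpha>"] by (simp add: algebra_simps)
  hence "(\<Sum>k. ?f k \<alpha>) = trapezoid a b (z * \<alpha>) * g \<alpha> - (a + b) * g \<alpha>" for \<alpha>
    by (simp add: sums_iff)
  with sums_integral[OF fi s1 s2] show ?thesis
    by (simp add: Bochner_Integration.integral_diff[OF Tg integrable_mult_right[OF gi]])
qed

text \<open>Every frequency \<open>real k * z\<close> with \<open>k > 0\<close> lies outside the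
  open support of the tent, so the mean is exact.\<close>

lemma trapezoid_integral:
  assumes c: "c > 0" and ab: "0 < a" "a < b" "b < 1/2" and z: "\<bar>z\<bar> \<ge> c"
  shows "(\<integral>\<alpha>. trapezoid a b (z * \<alpha>) \<partial>fejer_measure c) = a + b"
proof -
  interpret prob_space "fejer_measure c" by (rule prob_space_fejer_measure[OF c])
  have "trapezoid_coeff a b k * tent c (real k * z) = 0" for k
  proof (cases "k = 0")
    case False
    hence "\<bar>real k * z\<bar> \<ge> 1 * c" unfolding abs_mult using z c by (intro mult_mono) auto
    thus ?thesis using tent_eq_0[OF c] by simp
  qed (simp add: trapezoid_coeff_def)
  with trapezoid_integral_sums[OF c ab, of "\<lambda>_. 1" z] show ?thesis
    using prob_space by (simp add: fejer_measure_cos[OF c] sums_iff)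
qed

text \<open>The two factors are expanded one after the other. In the first expansion the constant
  term splits off as the product of the two means.\<close>

lemma trapezoid_correlation_sums:
  assumes c: "c > 0" and ab: "0 < a" "a < b" "b < 1/2" and z: "\<bar>z\<bar> \<ge> c" "\<bar>z'\<bar> \<ge> c"
  defines "D \<equiv> \<lambda>k. (\<integral>\<alpha>. cos (2 * pi * (real k * z) * \<alpha>) * trapezoid a b (z' * \<alpha>) \<partial>fejer_measure c)"
  shows "(\<lambda>k. trapezoid_coeff a b k * D k) sums
     ((\<integral>\<alpha>. trapezoid a b (z * \<alpha>) * trapezoid a b (z' * \<alpha>) \<partial>fejer_measure c) - (a + b)\<^sup>2)"
    and "k > 0 \<Longrightarrow> (\<lambda>l. trapezoid_coeff a b l * ((tent c (real k * z - real l * z') + tent c (real k * z + real l * z')) / 2)) sums D k"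
proof -
  have "(\<lambda>\<alpha>. trapezoid a b (z' * \<alpha>)) \<in> borel_measurable borel" by measurable
  from trapezoid_integral_sums[OF c ab this, of z] trapezoid_bounds[OF ab]
  show "(\<lambda>k. trapezoid_coeff a b k * D k) sums
     ((\<integral>\<alpha>. trapezoid a b (z * \<alpha>) * trapezoid a b (z' * \<alpha>) \<partial>fejer_measure c) - (a + b)\<^sup>2)"
    by (simp add: D_def trapezoid_integral[OF c ab z(2)] power2_eq_square)
next
  assume k: "k > 0"
  hence "\<bar>real k * z\<bar> \<ge> 1 * c" unfolding abs_mult using z c by (intro mult_mono) auto
  \<comment> \<open>This removes the constant term of the second trapezoid, so that both expansions
    run over nonzero frequencies only.\<close>
  hence t0: "tent c (real k * z) = 0" using tent_eq_0[OF c] by simp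
  have "D k = (\<integral>\<alpha>. trapezoid a b (z' * \<alpha>) * cos (2 * pi * (real k * z) * \<alpha>) \<partial>fejer_measure c)"
    unfolding D_def by (intro Bochner_Integration.integral_cong) auto
  hence "(\<lambda>l. trapezoid_coeff a b l * ((tent c (real l * z' - real k * z) + tent c (real l * z' + real k * z)) / 2)) sums D k"
    using trapezoid_integral_sums[OF c ab, of "\<lambda>\<alpha>. cos (2 * pi * (real k * z) * \<alpha>)" z']
    by (simp only: fejer_measure_cos_cos[OF c] fejer_measure_cos[OF c] t0) simp
  thus "(\<lambda>l. trapezoid_coeff a b l * ((tent c (real k * z - real l * z') + tent c (real k * z + real l * z')) / 2)) sums D k"
    by (simp add: tent_def abs_minus_commute add.commute)
qed

text \<open>Triangle inequality and interchange of a finite sum with a series. The bound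
  \<open>H\<close> is asked only where the weight is nonzero, which excludes frequency 0 in the
  applications.\<close>

lemma sum_abs_suminf_le:
  fixes b :: "nat \<Rightarrow> 'a \<Rightarrow> real"
  assumes fin: "finite A" and sm: "summable (\<lambda>k. \<bar>w k\<bar>)"
    and q: "\<And>i. i \<in> A \<Longrightarrow> (\<lambda>k. w k * b k i) sums q i"
    and H: "\<And>k. w k \<noteq> 0 \<Longrightarrow> (\<Sum>i\<in>A. \<bar>b k i\<bar>) \<le> H"
  shows "(\<Sum>i\<in>A. \<bar>q i\<bar>) \<le> (\<Sum>k. \<bar>w k\<bar>) * H"
proof -
  have le: "\<bar>w k * b k i\<bar> \<le> \<bar>w k\<bar> * H" if "i \<in> A" for i k
  proof (cases "w k = 0")
    case False
    have "\<bar>b k i\<bar> \<le> (\<Sum>i\<in>A. \<bar>b k i\<bar>)" using that fin by (intro member_le_sum) auto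
    with H[OF False] show ?thesis by (auto simp: abs_mult intro!: mult_left_mono)
  qed auto
  have sb: "summable (\<lambda>k. \<bar>w k * b k i\<bar>)" if "i \<in> A" for i
    by (rule summable_comparison_test'[OF summable_mult2[OF sm, of H]]) (use le that in auto)
  have "(\<Sum>i\<in>A. \<bar>q i\<bar>) \<le> (\<Sum>i\<in>A. \<Sum>k. \<bar>w k * b k i\<bar>)"
  proof (rule sum_mono)
    fix i assume i: "i \<in> A"
    show "\<bar>q i\<bar> \<le> (\<Sum>k. \<bar>w k * b k i\<bar>)"
      using summable_rabs[OF sb[OF i]] q[OF i] by (simp add: sums_iff)
  qed
  also have "\<dots> = (\<Sum>k. \<Sum>i\<in>A. \<bar>w k * b k i\<bar>)"
    by (rule suminf_sum[symmetric]) (rule sb)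
  also have "\<dots> \<le> (\<Sum>k. \<bar>w k\<bar> * H)"
  proof (rule suminf_le)
    show "(\<Sum>i\<in>A. \<bar>w k * b k i\<bar>) \<le> \<bar>w k\<bar> * H" for k
      using H[of k] by (cases "w k = 0") (auto simp: abs_mult simp flip: sum_distrib_left intro!: mult_left_mono)
    show "summable (\<lambda>k. \<Sum>i\<in>A. \<bar>w k * b k i\<bar>)" by (intro summable_sum sb)
    show "summable (\<lambda>k. \<bar>w k\<bar> * H)" by (rule summable_mult2[OF sm])
  qed
  also have "\<dots> = (\<Sum>k. \<bar>w k\<bar>) * H" by (rule suminf_mult2[OF sm, symmetric])
  finally show ?thesis .
qed

text \<open>The double sum is the integral of \<open>?S k \<alpha> * ?S l \<alpha>\<close> for
  cosine sums \<open>?S\<close>. Bounding a product by the mean of the squares reduces it to the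
  diagonal cases \<open>k = l\<close>, where \<open>H\<close> applies.\<close>

lemma sum_tent_le:
  assumes c: "c > 0" and J: "finite J"
    and H: "\<And>k::nat. k > 0 \<Longrightarrow> (\<Sum>(i,j)\<in>J\<times>J. (tent c (real k * z i - real k * z j) + tent c (real k * z i + real k * z j)) / 2) \<le> H"
    and kl: "k > 0" "l > 0"
  shows "(\<Sum>(i,j)\<in>J\<times>J. (tent c (real k * z i - real l * z j) + tent c (real k * z i + real l * z j)) / 2) \<le> H"
proof -
  interpret prob_space "fejer_measure c" by (rule prob_space_fejer_measure[OF c])
  let ?M = "fejer_measure c"
  let ?S = "\<lambda>k \<alpha>. \<Sum>i\<in>J. cos (2 * pi * (real k * z i) * \<alpha>)"
  have ci: "integrable ?M (\<lambda>\<alpha>. cos (2 * pi * u * \<alpha>) * cos (2 * pi * v * \<alpha>))" for u v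
    by (intro integrable_const_bound[where B = 1] AE_I2)
       (auto simp: abs_mult intro!: mult_le_one borel_measurable_times)
  have SS: "?S k \<alpha> * ?S l \<alpha> = (\<Sum>(i,j)\<in>J\<times>J. cos (2 * pi * (real k * z i) * \<alpha>) * cos (2 * pi * (real l * z j) * \<alpha>))" for k l \<alpha>
    by (simp add: sum_product sum.cartesian_product)
  have Si: "integrable ?M (\<lambda>\<alpha>. ?S k \<alpha> * ?S l \<alpha>)" for k l
    unfolding SS by (intro Bochner_Integration.integrable_sum) (auto intro!: ci)
  have eq: "(\<Sum>(i,j)\<in>J\<times>J. (tent c (real k * z i - real l * z j) + tent c (real k * z i + real l * z j)) / 2)
     = (\<integral>\<alpha>. ?S k \<alpha> * ?S l \<alpha> \<partial>?M)" for k l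
    unfolding SS
    by (subst Bochner_Integration.integral_sum)
       (auto intro!: ci sum.cong simp: fejer_measure_cos_cos[OF c] case_prod_unfold)
  have "(\<integral>\<alpha>. ?S k \<alpha> * ?S l \<alpha> \<partial>?M) \<le> (\<integral>\<alpha>. (?S k \<alpha> * ?S k \<alpha> + ?S l \<alpha> * ?S l \<alpha>) / 2 \<partial>?M)"
  proof (rule integral_mono)
    fix \<alpha>
    show "?S k \<alpha> * ?S l \<alpha> \<le> (?S k \<alpha> * ?S k \<alpha> + ?S l \<alpha> * ?S l \<alpha>) / 2"
      using sum_squares_bound[of "?S k \<alpha>" "?S l \<alpha>"] by (simp add: power2_eq_square)
  qed (intro Si Bochner_Integration.integrable_add integrable_divide_zero)+
  also have "\<dots> = ((\<integral>\<alpha>. ?S k \<alpha> * ?S k \<alpha> \<partial>?M) + (\<integral>\<alpha>. ?S l \<alpha> * ?S l \<alpha> \<partial>?M)) / 2"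
    using Bochner_Integration.integral_add[OF Si[of k k] Si[of l l]] by simp
  also have "\<dots> \<le> (H + H) / 2"
    using H[OF kl(1)] H[OF kl(2)] unfolding eq by (intro divide_right_mono add_mono) auto
  finally show ?thesis unfolding eq by simp
qed

text \<open>\<open>sum_abs_suminf_le\<close> is applied once per trapezoidal factor, each time at
  the cost of one absolute coefficient sum; hence the square.\<close>

lemma sum_trapezoid_correlation_le:
  assumes c: "c > 0" and ab: "0 < a" "a < b" "b < 1/2" and J: "finite J"
    and z: "\<And>j. j \<in> J \<Longrightarrow> \<bar>z j\<bar> \<ge> c"
    and H: "\<And>k::nat. k > 0 \<Longrightarrow> (\<Sum>(i,j)\<in>J\<times>J. (tent c (real k * z i - real k * z j) + tent c (real k * z i + real k * z j)) / 2) \<le> H"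
  shows "(\<Sum>(i,j)\<in>J\<times>J. \<bar>(\<integral>\<alpha>. trapezoid a b (z i * \<alpha>) * trapezoid a b (z j * \<alpha>) \<partial>fejer_measure c) - (a + b)\<^sup>2\<bar>)
     \<le> (\<Sum>k. \<bar>trapezoid_coeff a b k\<bar>)\<^sup>2 * H"
proof -
  let ?w = "trapezoid_coeff a b"
  let ?D = "\<lambda>k (i,j). (\<integral>\<alpha>. cos (2 * pi * (real k * z i) * \<alpha>) * trapezoid a b (z j * \<alpha>) \<partial>fejer_measure c)"
  let ?I = "\<lambda>k l (i,j). (tent c (real k * z i - real l * z j) + tent c (real k * z i + real l * z j)) / 2"
  have w0: "?w k \<noteq> 0 \<Longrightarrow> k > 0" for k by (cases k) (auto simp: trapezoid_coeff_def)
  note sm = trapezoid_coeff_summable[OF ab(1,2)]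
  have fin: "finite (J \<times> J)" using J by simp
  have D: "(\<Sum>p\<in>J\<times>J. \<bar>?D k p\<bar>) \<le> (\<Sum>k. \<bar>?w k\<bar>) * H" if k: "k > 0" for k
  proof (rule sum_abs_suminf_le[OF fin sm, where b = "?I k"])
    fix p assume "p \<in> J \<times> J"
    thus "(\<lambda>l. ?w l * ?I k l p) sums ?D k p"
      using trapezoid_correlation_sums(2)[OF c ab z z k] by (cases p) auto
  next
    fix l assume "?w l \<noteq> 0"
    hence "l > 0" by (rule w0)
    have "(\<Sum>p\<in>J\<times>J. \<bar>?I k l p\<bar>) = (\<Sum>p\<in>J\<times>J. ?I k l p)"
      using tent_bounds(1)[OF c] by (intro sum.cong) auto
    also have "\<dots> \<le> H" using sum_tent_le[OF c J H k \<open>l > 0\<close>] by simp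
    finally show "(\<Sum>p\<in>J\<times>J. \<bar>?I k l p\<bar>) \<le> H" .
  qed
  have "(\<Sum>p\<in>J\<times>J. \<bar>case p of (i,j) \<Rightarrow> (\<integral>\<alpha>. trapezoid a b (z i * \<alpha>) * trapezoid a b (z j * \<alpha>) \<partial>fejer_measure c) - (a + b)\<^sup>2\<bar>)
     \<le> (\<Sum>k. \<bar>?w k\<bar>) * ((\<Sum>k. \<bar>?w k\<bar>) * H)"
  proof (rule sum_abs_suminf_le[OF fin sm, where b = ?D])
    fix p assume "p \<in> J \<times> J"
    thus "(\<lambda>k. ?w k * ?D k p) sums (case p of (i,j) \<Rightarrow> (\<integral>\<alpha>. trapezoid a b (z i * \<alpha>) * trapezoid a b (z j * \<alpha>) \<partial>fejer_measure c) - (a + b)\<^sup>2)"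
      using trapezoid_correlation_sums(1)[OF c ab z z] by (cases p) auto
  qed (use D w0 in auto)
  thus ?thesis by (simp add: case_prod_unfold power2_eq_square mult.assoc)
qed

section \<open>The variance in higher dimension\<close>

text \<open>Written as a density against Lebesgue measure, so that almost-everywhere statements
  transfer through positivity of the density.\<close>

definition fejer_measure_vec :: "real \<Rightarrow> (real ^ 'd::finite) measure" where
  "fejer_measure_vec c = density lborel (\<lambda>v. ennreal (\<Prod>i\<in>UNIV. fejer_weight c (v $ i)))"

lemma sets_fejer_measure_vec [measurable_cong, simp]: "sets (fejer_measure_vec c) = sets borel"
  by (simp add: fejer_measure_vec_def)

lemma space_fejer_measure_vec [simp]: "space (fejer_measure_vec c) = UNIV"
  by (simp add: fejer_measure_vec_def)

lemma prod_Basis_vec: "(\<Prod>b\<in>Basis. f (x \<bullet> b)) = (\<Prod>i\<in>UNIV. f (x $ i))" for x :: "real ^ 'd::finite"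
proof -
  have B: "(Basis :: (real ^ 'd) set) = range (\<lambda>i. axis i 1)" by (auto simp: Basis_vec_def)
  have "inj (\<lambda>i::'d. axis i (1::real))" by (auto simp: inj_on_def axis_eq_axis)
  thus ?thesis unfolding B by (subst prod.reindex) (auto simp: inner_axis)
qed

text \<open>Tonelli's theorem: weight and integrand both factor over the coordinates. The
  nonnegative integral is computed first and gives integrability.\<close>

lemma fejer_measure_vec_prod:
  fixes g :: "real \<Rightarrow> real"
  assumes c: "c > 0" and g [measurable]: "g \<in> borel_measurable borel"
    and g0: "\<And>\<alpha>. 0 \<le> g \<alpha>" and g1: "\<And>\<alpha>. g \<alpha> \<le> 1"
  shows "integrable (fejer_measure_vec c) (\<lambda>v :: real ^ 'd::finite. \<Prod>i\<in>UNIV. g (v $ i))"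
    and "(\<integral>v. (\<Prod>i\<in>UNIV. g (v $ i)) \<partial>(fejer_measure_vec c :: (real ^ 'd) measure)) = (\<integral>\<alpha>. g \<alpha> \<partial>fejer_measure c) ^ CARD('d)"
proof -
  interpret prob_space "fejer_measure c" by (rule prob_space_fejer_measure[OF c])
  let ?M = "fejer_measure_vec c :: (real ^ 'd) measure"
  let ?w = "fejer_weight c"
  have gi: "integrable (fejer_measure c) g"
    by (rule integrable_const_bound[where B = 1]) (use g0 g1 in auto)
  note w0 = fejer_weight_nonneg[OF c]
  have meas: "(\<lambda>v :: real ^ 'd. \<Prod>i\<in>UNIV. h (v $ i)) \<in> borel_measurable borel"
    if [measurable]: "h \<in> borel_measurable borel" for h :: "real \<Rightarrow> real"
    by measurable
  have "(\<integral>\<^sup>+v. ennreal (\<Prod>i\<in>UNIV. g (v $ i)) \<partial>?M)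
     = (\<integral>\<^sup>+v. ennreal (\<Prod>i\<in>UNIV. ?w (v $ i)) * ennreal (\<Prod>i\<in>UNIV. g (v $ i)) \<partial>(lborel :: (real ^ 'd) measure))"
    unfolding fejer_measure_vec_def by (intro nn_integral_density) (auto intro!: measurable_compose[OF meas] meas)
  also have "\<dots> = (\<integral>\<^sup>+v. (\<Prod>b\<in>Basis. ennreal (?w (v \<bullet> b)) * ennreal (g (v \<bullet> b))) \<partial>(lborel :: (real ^ 'd) measure))"
    unfolding prod_Basis_vec[of "\<lambda>u. ennreal (?w u) * ennreal (g u)"]
    by (intro nn_integral_cong) (simp add: prod.distrib prod_ennreal[symmetric] w0 g0)
  also have "\<dots> = (\<Prod>b\<in>(Basis :: (real ^ 'd) set). (\<integral>\<^sup>+\<alpha>. ennreal (?w \<alpha>) * ennreal (g \<alpha>) \<partial>lborel))"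
    by (intro nn_integral_lborel_prod) auto
  also have "(\<integral>\<^sup>+\<alpha>. ennreal (?w \<alpha>) * ennreal (g \<alpha>) \<partial>lborel) = (\<integral>\<^sup>+\<alpha>. ennreal (g \<alpha>) \<partial>fejer_measure c)"
    unfolding fejer_measure_def by (intro nn_integral_density[symmetric]) auto
  also have "\<dots> = ennreal (\<integral>\<alpha>. g \<alpha> \<partial>fejer_measure c)"
    using g0 by (intro nn_integral_eq_integral[OF gi]) auto
  finally have nn: "(\<integral>\<^sup>+v. ennreal (\<Prod>i\<in>UNIV. g (v $ i)) \<partial>?M) = ennreal ((\<integral>\<alpha>. g \<alpha> \<partial>fejer_measure c) ^ CARD('d))"
    using g0 by (simp add: ennreal_power integral_nonneg_AE)
  have p0: "0 \<le> (\<Prod>i\<in>UNIV. g (v $ i))" for v :: "real ^ 'd" by (intro prod_nonneg) (use g0 in auto)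
  have m: "(\<lambda>v. \<Prod>i\<in>UNIV. g (v $ i)) \<in> borel_measurable ?M" using meas[OF g] by simp
  show int: "integrable ?M (\<lambda>v. \<Prod>i\<in>UNIV. g (v $ i))"
    by (rule integrableI_nonneg[OF m]) (use p0 nn in auto)
  show "(\<integral>v. (\<Prod>i\<in>UNIV. g (v $ i)) \<partial>?M) = (\<integral>\<alpha>. g \<alpha> \<partial>fejer_measure c) ^ CARD('d)"
    using p0 g0 by (intro integral_eq_nn_integral[OF m, THEN trans]) (auto simp: nn integral_nonneg_AE)
qed

lemma prob_space_fejer_measure_vec:
  assumes c: "c > 0"
  shows "prob_space (fejer_measure_vec c :: (real ^ 'd::finite) measure)"
proof
  interpret prob_space "fejer_measure c" by (rule prob_space_fejer_measure[OF c])
  let ?M = "fejer_measure_vec c :: (real ^ 'd) measure"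
  have i: "integrable ?M (\<lambda>v. 1::real)" "(\<integral>v. 1 \<partial>?M) = (1::real)"
    using fejer_measure_vec_prod[OF c, of "\<lambda>_. 1", where 'd = 'd] prob_space by simp_all
  have "(\<integral>\<^sup>+v. ennreal 1 \<partial>?M) = ennreal (\<integral>v. 1 \<partial>?M)"
    by (rule nn_integral_eq_integral) (use i in auto)
  thus "emeasure ?M (space ?M) = 1" using i by simp
qed

text \<open>The density is positive unless some coordinate is an integer multiple of
  \<open>1 / c\<close>, and these countably many hyperplanes are null sets.\<close>

lemma AE_lebesgue_if_AE_fejer_measure_vec:
  assumes c: "c > 0" and P: "AE v in (fejer_measure_vec c :: (real ^ 'd::finite) measure). P v"
  shows "AE v in lebesgue. P v"
proof -
  have "AE v :: real ^ 'd in lborel. 0 < ennreal (\<Prod>i\<in>UNIV. fejer_weight c (v $ i)) \<longrightarrow> P v"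
    using P unfolding fejer_measure_vec_def by (subst (asm) AE_density) auto
  hence 1: "AE v :: real ^ 'd in lebesgue. 0 < ennreal (\<Prod>i\<in>UNIV. fejer_weight c (v $ i)) \<longrightarrow> P v"
    by (rule AE_completion)
  have "AE v :: real ^ 'd in lebesgue. v $ i \<noteq> real_of_int n / c" for i n
    using negligible_standard_hyperplane[of "axis i (1::real) :: real ^ 'd" "real_of_int n / c"]
    by (auto simp: negligible_iff_null_sets inner_axis axis_in_Basis_iff dest: AE_not_in)
  hence 2: "AE v :: real ^ 'd in lebesgue. \<forall>i. \<forall>n. v $ i \<noteq> real_of_int n / c"
    by (auto simp: AE_all_countable)
  have pos: "fejer_weight c \<alpha> > 0" if "\<forall>n. \<alpha> \<noteq> real_of_int n / c" for \<alpha>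
  proof -
    have "cos (2 * pi * c * \<alpha>) \<noteq> 1"
    proof
      assume "cos (2 * pi * c * \<alpha>) = 1"
      then obtain n :: int where "2 * pi * c * \<alpha> = of_int n * 2 * pi"
        unfolding cos_one_2pi_int by auto
      hence "\<alpha> = of_int n / c" using c by (simp add: field_simps)
      with that show False by blast
    qed
    hence "cos (2 * pi * c * \<alpha>) < 1" using cos_le_one less_le by blast
    moreover have "\<alpha> \<noteq> 0" using that[rule_format, of 0] by simp
    ultimately show ?thesis using c by (simp add: fejer_weight_def)
  qed
  from 1 2 show ?thesis
    by eventually_elim (auto intro!: prod_pos pos simp: ennreal_less_zero_iff)
qed

text \<open>The factor \<open>u ^ (n - 1)\<close> is where the dimension helps: \<open>p\<close> is a one-dimensional correlation
  and \<open>u\<close> the mean of the bump.\<close>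

lemma power_diff_le:
  fixes p u :: real
  assumes "0 \<le> p" "p \<le> u" "0 < u" "u \<le> 1"
  shows "p ^ n - (u\<^sup>2) ^ n \<le> n * u ^ (n - 1) * \<bar>p - u\<^sup>2\<bar>"
proof (cases "n = 0")
  case False
  \<comment> \<open>Dividing by \<open>u\<close> puts both bases in [0, 1], where the power is
    Lipschitz with constant \<open>n\<close>, while the factor \<open>u ^ n\<close> stays
    outside.\<close>
  define q where "q = p / u"
  have q: "0 \<le> q" "q \<le> 1" "p = u * q" using assms by (auto simp: q_def)
  have "p ^ n - (u\<^sup>2) ^ n = u ^ n * (q ^ n - u ^ n)"
    by (simp add: q(3) power_mult_distrib power2_eq_square right_diff_distrib)
  also have "\<dots> \<le> u ^ n * (n * \<bar>q - u\<bar>)"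
    using norm_power_diff[of q u n] q assms by (intro mult_left_mono) auto
  also have "\<dots> = n * u ^ (n - 1) * (u * \<bar>q - u\<bar>)"
    using False by (simp add: power_eq_if)
  also have "u * \<bar>q - u\<bar> = \<bar>u * (q - u)\<bar>" using assms by (simp add: abs_mult)
  also have "u * (q - u) = p - u\<^sup>2" by (simp add: q(3) power2_eq_square algebra_simps)
  finally show ?thesis .
qed auto

text \<open>Since every \<open>F j\<close> has mean exactly \<open>(a + b) ^ CARD('d)\<close>,
  expanding the square leaves one covariance per pair. Each is a difference of powers of
  one-dimensional quantities, so \<open>power_diff_le\<close> reduces the sum to dimension
  one.\<close>

lemma trapezoid_variance:
  fixes z :: "'j \<Rightarrow> real"
  assumes c: "c > 0" and ab: "0 < a" "a < b" "b < 1/2" and J: "finite J"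
    and z: "\<And>j. j \<in> J \<Longrightarrow> \<bar>z j\<bar> \<ge> c"
    and H: "\<And>k::nat. k > 0 \<Longrightarrow> (\<Sum>(i,j)\<in>J\<times>J. (tent c (real k * z i - real k * z j) + tent c (real k * z i + real k * z j)) / 2) \<le> H"
  defines "F \<equiv> \<lambda>j (v :: real ^ 'd::finite). \<Prod>i\<in>UNIV. trapezoid a b (z j * v $ i)"
  shows "integrable (fejer_measure_vec c) (\<lambda>v. (\<Sum>j\<in>J. F j v - (a + b) ^ CARD('d))\<^sup>2)"
    and "(\<integral>v. (\<Sum>j\<in>J. F j v - (a + b) ^ CARD('d))\<^sup>2 \<partial>fejer_measure_vec c)
     \<le> real CARD('d) * (a + b) ^ (CARD('d) - 1) * ((\<Sum>k. \<bar>trapezoid_coeff a b k\<bar>)\<^sup>2 * H)"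
proof -
  let ?M = "fejer_measure_vec c :: (real ^ 'd) measure"
  let ?d = "CARD('d)"
  define m where "m = (a + b) ^ ?d"
  define P where "P i j = (\<integral>\<alpha>. trapezoid a b (z i * \<alpha>) * trapezoid a b (z j * \<alpha>) \<partial>fejer_measure c)" for i j
  interpret prob_space "fejer_measure c" by (rule prob_space_fejer_measure[OF c])
  interpret V: prob_space ?M by (rule prob_space_fejer_measure_vec[OF c])
  note T = trapezoid_bounds[OF ab]
  have Fi: "integrable ?M (F j)" for j
    unfolding F_def by (rule fejer_measure_vec_prod[OF c]) (use T in auto)
  have EF: "(\<integral>v. F j v \<partial>?M) = m" if "j \<in> J" for j
    unfolding F_def m_def
    by (subst fejer_measure_vec_prod[OF c]) (use T in \<open>auto simp: trapezoid_integral[OF c ab z[OF that]]\<close>)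
  have FF: "F i v * F j v = (\<Prod>l\<in>UNIV. trapezoid a b (z i * v $ l) * trapezoid a b (z j * v $ l))" for i j v
    by (simp add: F_def prod.distrib)
  have FFi: "integrable ?M (\<lambda>v. F i v * F j v)" for i j
    unfolding FF by (rule fejer_measure_vec_prod[OF c]) (use T in \<open>auto intro: mult_le_one\<close>)
  have EFF: "(\<integral>v. F i v * F j v \<partial>?M) = P i j ^ ?d" for i j
    unfolding FF P_def by (subst fejer_measure_vec_prod[OF c]) (use T in \<open>auto intro: mult_le_one\<close>)
  have Ti: "integrable (fejer_measure c) (\<lambda>\<alpha>. trapezoid a b (z i * \<alpha>))" for i
    by (rule integrable_const_bound[where B = 1]) (use T in auto)
  have TTi: "integrable (fejer_measure c) (\<lambda>\<alpha>. trapezoid a b (z i * \<alpha>) * trapezoid a b (z j * \<alpha>))" for i j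
    by (rule integrable_const_bound[where B = 1]) (use T in \<open>auto intro: mult_le_one simp: abs_mult\<close>)
  have P0: "0 \<le> P i j" for i j unfolding P_def using T by (intro integral_nonneg_AE) auto
  \<comment> \<open>The second factor is at most 1, so the correlation is at most the mean of the
    first.\<close>
  have P1: "P i j \<le> a + b" if "i \<in> J" for i j
    unfolding P_def trapezoid_integral[OF c ab z[OF that], symmetric]
    by (rule integral_mono[OF TTi Ti]) (use T in \<open>auto intro: mult_left_le\<close>)
  have sq: "(\<Sum>j\<in>J. F j v - m)\<^sup>2
     = (\<Sum>p\<in>J\<times>J. F (fst p) v * F (snd p) v - m * F (fst p) v - m * F (snd p) v + m\<^sup>2)" for v
    by (simp add: power2_eq_square sum_product sum.cartesian_product case_prod_unfold algebra_simps)
  show "integrable ?M (\<lambda>v. (\<Sum>j\<in>J. F j v - (a + b) ^ ?d)\<^sup>2)"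
    unfolding m_def[symmetric] sq using Fi FFi by auto
  have "(\<integral>v. (\<Sum>j\<in>J. F j v - m)\<^sup>2 \<partial>?M)
     = (\<integral>v. (\<Sum>p\<in>J\<times>J. F (fst p) v * F (snd p) v - m * F (fst p) v - m * F (snd p) v + m\<^sup>2) \<partial>?M)"
    unfolding sq ..
  also have "\<dots> = (\<Sum>p\<in>J\<times>J. \<integral>v. F (fst p) v * F (snd p) v - m * F (fst p) v - m * F (snd p) v + m\<^sup>2 \<partial>?M)"
    by (rule Bochner_Integration.integral_sum) (use Fi FFi in auto)
  also have "\<dots> = (\<Sum>p\<in>J\<times>J. P (fst p) (snd p) ^ ?d - ((a + b)\<^sup>2) ^ ?d)"
  proof (intro sum.cong refl)
    fix p assume p: "p \<in> J \<times> J"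
    have "(\<integral>v. F (fst p) v * F (snd p) v - m * F (fst p) v - m * F (snd p) v + m\<^sup>2 \<partial>?M)
      = P (fst p) (snd p) ^ ?d - m * m - m * m + m\<^sup>2"
      using p Fi FFi V.prob_space by (simp add: EF EFF mem_Times_iff)
    also have "\<dots> = P (fst p) (snd p) ^ ?d - ((a + b)\<^sup>2) ^ ?d"
      by (simp add: m_def power2_eq_square power_mult_distrib)
    finally show "(\<integral>v. F (fst p) v * F (snd p) v - m * F (fst p) v - m * F (snd p) v + m\<^sup>2 \<partial>?M)
      = P (fst p) (snd p) ^ ?d - ((a + b)\<^sup>2) ^ ?d" .
  qed
  also have "\<dots> \<le> (\<Sum>p\<in>J\<times>J. real ?d * (a + b) ^ (?d - 1) * \<bar>P (fst p) (snd p) - (a + b)\<^sup>2\<bar>)"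
    using ab by (intro sum_mono power_diff_le P0 P1) auto
  also have "\<dots> = real ?d * (a + b) ^ (?d - 1) * (\<Sum>(i,j)\<in>J\<times>J. \<bar>P i j - (a + b)\<^sup>2\<bar>)"
    by (simp add: sum_distrib_left case_prod_unfold)
  also have "\<dots> \<le> real ?d * (a + b) ^ (?d - 1) * ((\<Sum>k. \<bar>trapezoid_coeff a b k\<bar>)\<^sup>2 * H)"
    unfolding P_def using ab by (intro mult_left_mono sum_trapezoid_correlation_le[OF c ab J z H]) auto
  finally show "(\<integral>v. (\<Sum>j\<in>J. F j v - (a + b) ^ ?d)\<^sup>2 \<partial>?M)
     \<le> real ?d * (a + b) ^ (?d - 1) * ((\<Sum>k. \<bar>trapezoid_coeff a b k\<bar>)\<^sup>2 * H)" unfolding m_def .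
qed

section \<open>Pair counts and additive energy\<close>

text \<open>A Borel-Cantelli argument: the sum of the functions has finite integral, hence is finite
  almost everywhere, and the terms of a convergent series tend to 0.\<close>

lemma AE_tendsto_0_if_summable_integral:
  fixes f :: "nat \<Rightarrow> 'a \<Rightarrow> real"
  assumes ev: "\<forall>\<^sub>F k in sequentially. integrable M (f k) \<and> (\<integral>x. f k x \<partial>M) \<le> B k"
    and nn: "\<And>k x. 0 \<le> f k x" and B: "summable B"
  shows "AE x in M. (\<lambda>k. f k x) \<longlonglongrightarrow> 0"
proof -
  obtain K where K: "\<And>k. k \<ge> K \<Longrightarrow> integrable M (f k) \<and> (\<integral>x. f k x \<partial>M) \<le> B k"
    using ev by (auto simp: eventually_sequentially)
  define g where "g k = f (k + K)" for k
  have gi: "integrable M (g k)" and gB: "(\<integral>x. g k x \<partial>M) \<le> B (k + K)" for k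
    using K[of "k + K"] by (auto simp: g_def)
  have g0: "0 \<le> g k x" for k x by (simp add: g_def nn)
  have B0: "0 \<le> B (k + K)" for k
    using gB[of k] Bochner_Integration.integral_nonneg[of M "g k"] g0 order_trans by blast
  have "(\<integral>\<^sup>+x. (\<Sum>k. ennreal (g k x)) \<partial>M) = (\<Sum>k. \<integral>\<^sup>+x. ennreal (g k x) \<partial>M)"
    using gi by (intro nn_integral_suminf) auto
  also have "\<dots> = (\<Sum>k. ennreal (\<integral>x. g k x \<partial>M))"
    using g0 by (intro suminf_cong nn_integral_eq_integral gi) auto
  also have "\<dots> \<le> (\<Sum>k. ennreal (B (k + K)))"
    using gB by (intro suminf_le ennreal_leI) auto
  also have "\<dots> = ennreal (\<Sum>k. B (k + K))"
    using B0 B by (intro suminf_ennreal2) (auto simp: summable_iff_shift)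
  also have "\<dots> < \<infinity>" by simp
  finally have "(\<integral>\<^sup>+x. (\<Sum>k. ennreal (g k x)) \<partial>M) \<noteq> \<infinity>" by simp
  moreover have "(\<lambda>x. \<Sum>k. ennreal (g k x)) \<in> borel_measurable M" using gi by measurable
  ultimately have "AE x in M. (\<Sum>k. ennreal (g k x)) \<noteq> \<infinity>"
    by (intro nn_integral_PInf_AE)
  thus ?thesis
  proof eventually_elim
    case (elim x)
    hence "summable (\<lambda>k. g k x)" using g0 by (intro summable_suminf_not_top) auto
    hence "(\<lambda>k. g k x) \<longlonglongrightarrow> 0" by (rule summable_LIMSEQ_zero)
    thus ?case unfolding g_def by (rule LIMSEQ_offset)
  qed
qed

section \<open>Pairs of distinct indices and the additive energy\<close>

definition offdiag :: "nat \<Rightarrow> (nat \<times> nat) set" where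
  "offdiag N = {(n, m). n \<in> {1..N} \<and> m \<in> {1..N} \<and> n \<noteq> m}"

lemma offdiag_eq: "offdiag N = {1..N} \<times> {1..N} - (\<lambda>n. (n, n)) ` {1..N}"
  by (auto simp: offdiag_def)

lemma finite_offdiag [simp]: "finite (offdiag N)"
  by (simp add: offdiag_eq)

lemma card_offdiag: "card (offdiag N) = N * N - N"
proof -
  have "card ((\<lambda>n. (n, n)) ` {1..N}) = N" by (subst card_image) (auto simp: inj_on_def)
  thus ?thesis unfolding offdiag_eq by (subst card_Diff_subset) auto
qed

lemma gap_le_abs_diff:
  fixes x :: "nat \<Rightarrow> real"
  assumes gap: "\<And>n. n \<ge> 1 \<Longrightarrow> x (n + 1) - x n \<ge> c" and c: "c > 0"
    and "n \<ge> 1" "m \<ge> 1" "n \<noteq> m"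
  shows "c \<le> \<bar>x n - x m\<bar>"
proof -
  have *: "c \<le> x (m + Suc j) - x m" if "m \<ge> 1" for m j
  proof (induction j)
    case (Suc j)
    thus ?case using gap[of "m + Suc j"] that c by simp
  qed (use gap[OF that] in simp)
  show ?thesis
  proof (cases "n < m")
    case True
    then obtain j where j: "m = n + Suc j" using less_imp_Suc_add by fastforce
    show ?thesis unfolding j using *[OF \<open>n \<ge> 1\<close>, of j] c by linarith
  next
    case False
    with assms obtain j where j: "n = m + Suc j" using less_imp_Suc_add[of m n] by fastforce
    show ?thesis unfolding j using *[OF \<open>m \<ge> 1\<close>, of j] c by linarith
  qed
qed

text \<open>Dilation by \<open>k\<close> only shrinks the support, and \<open>c \<le> 1\<close> fits
  that support to the threshold 1 in the additive energy.\<close>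

lemma tent_scaled_le:
  assumes "0 < c" "c \<le> 1" "k > 0"
  shows "tent c (real k * u) \<le> of_bool (\<bar>u\<bar> < 1)"
proof (cases "\<bar>u\<bar> < 1")
  case False
  hence "1 * 1 \<le> real k * \<bar>u\<bar>" using assms by (intro mult_mono) auto
  hence "c \<le> \<bar>real k * u\<bar>" using assms by (simp add: abs_mult)
  thus ?thesis using tent_eq_0[OF assms(1)] by simp
qed (use tent_bounds(2)[OF assms(1)] in simp)

text \<open>Both the difference and the sum of two values of \<open>z\<close> are of the form
  \<open>x n1 + x n2 - x n3 - x n4\<close> after permuting the indices, so each tent sum injects
  into the energy count. The factor 1/2 averages the two.\<close>

lemma sum_tent_le_additive_energy:
  fixes x :: "nat \<Rightarrow> real"
  assumes c: "0 < c" "c \<le> 1" and k: "k > 0"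
  defines "z \<equiv> \<lambda>p. x (fst p) - x (snd p)"
  shows "(\<Sum>(i,j)\<in>offdiag N \<times> offdiag N. (tent c (real k * z i - real k * z j) + tent c (real k * z i + real k * z j)) / 2)
     \<le> real (additive_energy x N)"
proof -
  let ?J2 = "offdiag N \<times> offdiag N"
  let ?E = "{(n1, n2, n3, n4). n1 \<in> {1..N} \<and> n2 \<in> {1..N} \<and> n3 \<in> {1..N} \<and> n4 \<in> {1..N} \<and>
             \<bar>x n1 + x n2 - x n3 - x n4\<bar> < 1}"
  have finE: "finite ?E"
    by (rule finite_subset[of _ "{1..N} \<times> {1..N} \<times> {1..N} \<times> {1..N}"]) auto
  have "card {p \<in> ?J2. \<bar>z (fst p) - z (snd p)\<bar> < 1} \<le> card ?E"
    by (rule card_inj_on_le[where f = "\<lambda>((n, m), (n', m')). (n, m', m, n')", OF _ _ finE])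
       (auto simp: inj_on_def offdiag_def z_def algebra_simps)
  moreover have "card {p \<in> ?J2. \<bar>z (fst p) + z (snd p)\<bar> < 1} \<le> card ?E"
    by (rule card_inj_on_le[where f = "\<lambda>((n, m), (n', m')). (n, n', m, m')", OF _ _ finE])
       (auto simp: inj_on_def offdiag_def z_def algebra_simps)
  ultimately have cards: "real (card {p \<in> ?J2. \<bar>z (fst p) - z (snd p)\<bar> < 1}) \<le> real (additive_energy x N)"
    "real (card {p \<in> ?J2. \<bar>z (fst p) + z (snd p)\<bar> < 1}) \<le> real (additive_energy x N)"
    by (simp_all add: additive_energy_def)
  have "(\<Sum>(i,j)\<in>?J2. (tent c (real k * z i - real k * z j) + tent c (real k * z i + real k * z j)) / 2)
     \<le> (\<Sum>p\<in>?J2. (of_bool (\<bar>z (fst p) - z (snd p)\<bar> < 1) + of_bool (\<bar>z (fst p) + z (snd p)\<bar> < 1)) / 2)"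
    unfolding case_prod_unfold
    using tent_scaled_le[OF c k]
    by (intro sum_mono divide_right_mono add_mono) (auto simp flip: distrib_left right_diff_distrib)
  also have "\<dots> = (real (card {p \<in> ?J2. \<bar>z (fst p) - z (snd p)\<bar> < 1}) + real (card {p \<in> ?J2. \<bar>z (fst p) + z (snd p)\<bar> < 1})) / 2"
    by (simp add: sum.distrib sum_of_bool_eq Int_def flip: sum_divide_distrib)
  also have "\<dots> \<le> real (additive_energy x N)" using cards by simp
  finally show ?thesis .
qed

text \<open>The lattice vector can be chosen coordinate by coordinate. Rounding gives the nearest
  integer, so each coordinate's distance to the integers bounds the infimum from below.\<close>

lemma torus_infnorm_le_iff:
  "torus_infnorm v \<le> r \<longleftrightarrow> (\<forall>i. \<exists>k::int. \<bar>v $ i + of_int k\<bar> \<le> r)" for v :: "real ^ 'd::finite"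
proof
  assume le: "torus_infnorm v \<le> r"
  show "\<forall>i. \<exists>k::int. \<bar>v $ i + of_int k\<bar> \<le> r"
  proof
    fix i
    have "\<bar>v $ i - of_int (round (v $ i))\<bar> \<le> torus_infnorm v"
      unfolding torus_infnorm_def
    proof (rule cINF_greatest)
      fix k :: "int ^ 'd"
      have "\<bar>v $ i - of_int (round (v $ i))\<bar> \<le> \<bar>v $ i - of_int (- k $ i)\<bar>"
        by (rule round_diff_minimal)
      also have "\<dots> = \<bar>(v + (\<chi> i. of_int (k $ i))) $ i\<bar>" by simp
      also have "\<dots> \<le> infnorm (v + (\<chi> i. of_int (k $ i)))" by (rule component_le_infnorm_cart)
      finally show "\<bar>v $ i - of_int (round (v $ i))\<bar> \<le> infnorm (v + (\<chi> i. of_int (k $ i)))" .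
    qed auto
    with le show "\<exists>k::int. \<bar>v $ i + of_int k\<bar> \<le> r"
      by (intro exI[of _ "- round (v $ i)"]) auto
  qed
next
  assume "\<forall>i. \<exists>k::int. \<bar>v $ i + of_int k\<bar> \<le> r"
  then obtain k where k: "\<And>i. \<bar>v $ i + real_of_int (k i)\<bar> \<le> r" by metis
  have "torus_infnorm v \<le> infnorm (v + (\<chi> i. of_int ((\<chi> i. k i) $ i)))"
    unfolding torus_infnorm_def
    by (rule cINF_lower) (auto intro!: bdd_belowI[of _ 0] infnorm_pos_le)
  also have "\<dots> \<le> r"
    unfolding infnorm_cart by (rule cSup_least) (auto simp: k)
  finally show "torus_infnorm v \<le> r" .
qed

text \<open>The radius is an argument separate from \<open>N\<close>, making the count monotone in
  both; the passage from a subsequence to all \<open>N\<close> rests on this.\<close>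

definition frac_pair_count :: "(nat \<Rightarrow> real) \<Rightarrow> real ^ 'd::finite \<Rightarrow> nat \<Rightarrow> real \<Rightarrow> real" where
  "frac_pair_count x \<alpha> N r = real (card {p \<in> offdiag N. \<forall>i. \<exists>k::int. \<bar>(x (fst p) - x (snd p)) * \<alpha> $ i + of_int k\<bar> \<le> r})"

text \<open>Taking fractional parts changes a difference by an integer, which the quantified
  \<open>k\<close> absorbs.\<close>

lemma pair_corr_infnorm_frac:
  "pair_corr_infnorm s (\<lambda>n. \<chi> i. frac (x n * \<alpha> $ i)) N =
     frac_pair_count x \<alpha> N (s / real N powr (1 / real CARD('d))) / real N" for \<alpha> :: "real ^ 'd::finite"
proof -
  have "(\<exists>k::int. \<bar>frac (x n * \<alpha> $ i) - frac (x m * \<alpha> $ i) + of_int k\<bar> \<le> r) \<longleftrightarrow>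
        (\<exists>k::int. \<bar>(x n - x m) * \<alpha> $ i + of_int k\<bar> \<le> r)" (is "?A \<longleftrightarrow> ?B") for n m i r
  proof
    assume ?A
    then obtain k :: int where "\<bar>frac (x n * \<alpha> $ i) - frac (x m * \<alpha> $ i) + of_int k\<bar> \<le> r" by blast
    thus ?B by (intro exI[of _ "k - \<lfloor>x n * \<alpha> $ i\<rfloor> + \<lfloor>x m * \<alpha> $ i\<rfloor>"]) (simp add: frac_def algebra_simps)
  next
    assume ?B
    then obtain k :: int where "\<bar>(x n - x m) * \<alpha> $ i + of_int k\<bar> \<le> r" by blast
    thus ?A by (intro exI[of _ "k + \<lfloor>x n * \<alpha> $ i\<rfloor> - \<lfloor>x m * \<alpha> $ i\<rfloor>"]) (simp add: frac_def algebra_simps)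
  qed
  hence "{(n, m). n \<in> {1..N} \<and> m \<in> {1..N} \<and> n \<noteq> m \<and>
       torus_infnorm ((\<chi> i. frac (x n * \<alpha> $ i)) - (\<chi> i. frac (x m * \<alpha> $ i)) :: real ^ 'd) \<le> r}
     = {p \<in> offdiag N. \<forall>i. \<exists>k::int. \<bar>(x (fst p) - x (snd p)) * \<alpha> $ i + of_int k\<bar> \<le> r}" for r
    unfolding torus_infnorm_le_iff by (auto simp: offdiag_def)
  thus ?thesis by (simp add: pair_corr_infnorm_def frac_pair_count_def)
qed

lemma frac_pair_count_mono:
  assumes "M \<le> N" "r \<le> t"
  shows "frac_pair_count x \<alpha> M r \<le> frac_pair_count x \<alpha> N t"
  unfolding frac_pair_count_def of_nat_le_iff
proof (rule card_mono)
  show "finite {p \<in> offdiag N. \<forall>i. \<exists>k::int. \<bar>(x (fst p) - x (snd p)) * \<alpha> $ i + of_int k\<bar> \<le> t}"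
    by (rule finite_subset[OF _ finite_offdiag]) auto
qed (use assms in \<open>auto simp: offdiag_def intro: order_trans, meson order_trans\<close>)

text \<open>All factors are 1 when every coordinate is within \<open>a\<close> of an integer, and
  some factor is 0 when a coordinate is farther than \<open>b\<close> from all integers.\<close>

lemma frac_pair_count_trapezoid:
  fixes \<alpha> :: "real ^ 'd::finite" and x :: "nat \<Rightarrow> real" and N :: nat
  assumes ab: "0 < a" "a < b" "b < 1/2"
  defines "S \<equiv> (\<Sum>p\<in>offdiag N. \<Prod>i\<in>UNIV. trapezoid a b ((x (fst p) - x (snd p)) * \<alpha> $ i))"
  shows "frac_pair_count x \<alpha> N a \<le> S" "S \<le> frac_pair_count x \<alpha> N b"
proof -
  let ?Q = "\<lambda>r p. \<forall>i. \<exists>k::int. \<bar>(x (fst p) - x (snd p)) * \<alpha> $ i + of_int k\<bar> \<le> r"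
  have cnt: "frac_pair_count x \<alpha> N r = (\<Sum>p\<in>offdiag N. of_bool (?Q r p))" for r
    by (simp add: frac_pair_count_def sum_of_bool_eq Int_def)
  note T = trapezoid_bounds[OF ab]
  show "frac_pair_count x \<alpha> N a \<le> S"
    unfolding cnt S_def
  proof (rule sum_mono)
    fix p
    show "of_bool (?Q a p) \<le> (\<Prod>i\<in>UNIV. trapezoid a b ((x (fst p) - x (snd p)) * \<alpha> $ i))"
    proof (cases "?Q a p")
      case True
      hence "trapezoid a b ((x (fst p) - x (snd p)) * \<alpha> $ i) = 1" for i
        using trapezoid_eq_1[OF ab] by blast
      thus ?thesis using True by simp
    qed (auto intro!: prod_nonneg T)
  qed
  show "S \<le> frac_pair_count x \<alpha> N b"
    unfolding cnt S_def
  proof (rule sum_mono)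
    fix p
    show "(\<Prod>i\<in>UNIV. trapezoid a b ((x (fst p) - x (snd p)) * \<alpha> $ i)) \<le> of_bool (?Q b p)"
    proof (cases "?Q b p")
      case True
      thus ?thesis by (auto intro!: prod_le_1 T)
    next
      case False
      then obtain i where "\<not> (\<exists>k::int. \<bar>(x (fst p) - x (snd p)) * \<alpha> $ i + of_int k\<bar> \<le> b)" by blast
      hence "\<not> 0 < trapezoid a b ((x (fst p) - x (snd p)) * \<alpha> $ i)"
        using trapezoid_pos_imp[OF ab] by blast
      hence "trapezoid a b ((x (fst p) - x (snd p)) * \<alpha> $ i) = 0" using T(1) by (meson antisym not_le)
      hence eq: "(\<Prod>i\<in>UNIV. trapezoid a b ((x (fst p) - x (snd p)) * \<alpha> $ i)) = 0" by (intro prod_zero) auto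
      show ?thesis unfolding eq by simp
    qed
  qed
qed

section \<open>Almost sure convergence\<close>

text \<open>Consecutive \<open>q\<close>-th powers have ratio tending to 1, so monotonicity traps
  the count at \<open>N\<close> between counts at neighbouring powers with slightly changed radii.
  Only rational radii enter, to allow a countable union of null sets later.\<close>

lemma tendsto_of_polynomial_subsequence:
  fixes cnt :: "nat \<Rightarrow> real \<Rightarrow> real" and d q :: nat
  assumes d: "d > 0" and q: "q > 0"
    and mono: "\<And>M N r t. M \<le> N \<Longrightarrow> r \<le> t \<Longrightarrow> cnt M r \<le> cnt N t"
    and nn: "\<And>N r. 0 \<le> cnt N r"
    and L: "\<And>\<sigma> \<tau>. \<sigma> \<in> \<rat> \<Longrightarrow> \<tau> \<in> \<rat> \<Longrightarrow> 0 < \<sigma> \<Longrightarrow> \<sigma> < \<tau> \<Longrightarrow>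
       \<exists>S. (\<lambda>k. S k / real (k ^ q)) \<longlonglongrightarrow> (\<sigma> + \<tau>) ^ d \<and>
         (\<forall>\<^sub>F k in sequentially. cnt (k ^ q) (\<sigma> / real (k ^ q) powr (1 / real d)) \<le> S k \<and>
                               S k \<le> cnt (k ^ q) (\<tau> / real (k ^ q) powr (1 / real d)))"
    and s: "s > 0"
  shows "(\<lambda>N. cnt N (s / real N powr (1 / real d)) / real N) \<longlonglongrightarrow> (2 * s) ^ d"
proof -
  \<comment> \<open>The index \<open>k\<close> with
    \<open>k ^ q \<le> N < (k + 1) ^ q\<close>.\<close>
  define kk where "kk N = nat \<lfloor>root q (real N)\<rfloor>" for N
  have kk1: "kk N ^ q \<le> N" for N
  proof -
    have "real (kk N) ^ q \<le> root q (real N) ^ q"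
      unfolding kk_def by (intro power_mono of_nat_floor real_root_ge_zero) auto
    also have "\<dots> = real N" using q by simp
    finally show ?thesis by (simp flip: of_nat_power)
  qed
  have kk2: "N < Suc (kk N) ^ q" for N
  proof -
    have "real N = root q (real N) ^ q" using q by simp
    also have "root q (real N) < real (Suc (kk N))" unfolding kk_def by linarith
    hence "root q (real N) ^ q < real (Suc (kk N)) ^ q"
      by (intro power_strict_mono) (use q in auto)
    finally show ?thesis by (simp only: of_nat_power[symmetric] of_nat_less_iff)
  qed
  have kk_top: "filterlim kk sequentially sequentially"
    unfolding filterlim_at_top
  proof (intro allI)
    fix K
    show "\<forall>\<^sub>F N in sequentially. K \<le> kk N"
      using eventually_ge_at_top[of "K ^ q"]
    proof eventually_elim
      case (elim N)
      hence "K ^ q < Suc (kk N) ^ q" using kk2[of N] by linarith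
      hence "K < Suc (kk N)" by (rule power_less_imp_less_base) simp
      thus ?case by simp
    qed
  qed
  have kk_Suc_top: "filterlim (\<lambda>N. Suc (kk N)) sequentially sequentially"
    by (rule filterlim_compose[OF filterlim_Suc kk_top])
  have ratio: "(\<lambda>k. real (Suc k ^ q) / real (k ^ q)) \<longlonglongrightarrow> 1"
  proof -
    have "(\<lambda>k. real (Suc k) / real k) \<longlonglongrightarrow> 1" by real_asymp
    from tendsto_power[OF this, of q] show ?thesis by (simp add: power_divide del: of_nat_Suc)
  qed
  have ratio_powr: "(\<lambda>k. real (Suc k ^ q) powr (1 / real d) / real (k ^ q) powr (1 / real d)) \<longlonglongrightarrow> 1"
  proof -
    have "(\<lambda>k. (real (Suc k ^ q) / real (k ^ q)) powr (1 / real d)) \<longlonglongrightarrow> 1 powr (1 / real d)"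
      by (intro tendsto_powr ratio tendsto_const) auto
    thus ?thesis by (simp add: powr_divide del: of_nat_Suc of_nat_power)
  qed
  \<comment> \<open>The gap between \<open>u\<close> and \<open>v\<close> absorbs the change of
    scale from one power to the next.\<close>
  have compare: "\<forall>\<^sub>F k in sequentially. k > 0 \<and> u / real (k ^ q) powr (1 / real d) \<le> v / real (Suc k ^ q) powr (1 / real d)"
    if "0 < u" "u < v" for u v
  proof -
    have "1 < v / u" using that by simp
    from order_tendstoD(2)[OF ratio_powr this] eventually_gt_at_top[of 0] show ?thesis
    proof eventually_elim
      case (elim k)
      moreover have "0 < real (k ^ q) powr (1 / real d)" "0 < real (Suc k ^ q) powr (1 / real d)"
        using elim(2) by (auto simp del: of_nat_power)
      ultimately show ?case using that by (auto simp: divide_simps mult.commute less_imp_le)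
    qed
  qed
  have cont: "isCont (\<lambda>t. (2 * t) ^ d) s" by (intro continuous_intros)
  let ?R = "\<lambda>N. cnt N (s / real N powr (1 / real d)) / real N"
  have upper: "\<forall>\<^sub>F N in sequentially. ?R N < u" if u: "(2 * s) ^ d < u" for u
  proof -
    have "\<forall>\<^sub>F t in at s. (2 * t) ^ d < u"
      using order_tendstoD(2)[OF cont[unfolded isCont_def] u] .
    then obtain \<delta> where \<delta>: "\<delta> > 0" "\<And>t. t \<noteq> s \<Longrightarrow> dist t s < \<delta> \<Longrightarrow> (2 * t) ^ d < u"
      by (auto simp: eventually_at)
    \<comment> \<open>For the upper bound both radii lie above \<open>s\<close>:
      \<open>\<sigma>\<close> dominates the count after rescaling, and \<open>\<tau>\<close> close
      to \<open>s\<close> keeps the limit below \<open>u\<close>.\<close>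
    obtain \<tau> where \<tau>: "\<tau> \<in> \<rat>" "s < \<tau>" "\<tau> < s + \<delta>" using Rats_dense_in_real[of s "s + \<delta>"] \<delta> by auto
    obtain \<sigma> where \<sigma>: "\<sigma> \<in> \<rat>" "s < \<sigma>" "\<sigma> < \<tau>" using Rats_dense_in_real[of s \<tau>] \<tau> by auto
    have "(\<sigma> + \<tau>) ^ d \<le> (2 * \<tau>) ^ d" using \<sigma> s by (intro power_mono) auto
    also have "\<dots> < u" using \<delta>(2)[of \<tau>] \<tau> by (auto simp: dist_real_def)
    finally have lt: "(\<sigma> + \<tau>) ^ d < u" .
    obtain S where S: "(\<lambda>k. S k / real (k ^ q)) \<longlonglongrightarrow> (\<sigma> + \<tau>) ^ d"
      "\<forall>\<^sub>F k in sequentially. cnt (k ^ q) (\<sigma> / real (k ^ q) powr (1 / real d)) \<le> S k \<and>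
                               S k \<le> cnt (k ^ q) (\<tau> / real (k ^ q) powr (1 / real d))"
      using L[of \<sigma> \<tau>] \<sigma> \<tau> s by auto
    have "(\<lambda>k. S (Suc k) / real (Suc k ^ q) * (real (Suc k ^ q) / real (k ^ q))) \<longlonglongrightarrow> (\<sigma> + \<tau>) ^ d * 1"
      by (intro tendsto_mult ratio filterlim_compose[OF S(1) filterlim_Suc])
    hence "(\<lambda>k. S (Suc k) / real (k ^ q)) \<longlonglongrightarrow> (\<sigma> + \<tau>) ^ d" by (simp del: of_nat_Suc power_Suc of_nat_power)
    from order_tendstoD(2)[OF filterlim_compose[OF this kk_top] lt]
    have "\<forall>\<^sub>F N in sequentially. S (Suc (kk N)) / real (kk N ^ q) < u" .
    moreover have "\<forall>\<^sub>F N in sequentially. cnt (Suc (kk N) ^ q) (\<sigma> / real (Suc (kk N) ^ q) powr (1 / real d)) \<le> S (Suc (kk N))"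
      using filterlim_iff[THEN iffD1, OF kk_Suc_top, rule_format, OF S(2)] by eventually_elim auto
    moreover have "\<forall>\<^sub>F N in sequentially. kk N > 0 \<and>
        s / real (kk N ^ q) powr (1 / real d) \<le> \<sigma> / real (Suc (kk N) ^ q) powr (1 / real d)"
      using filterlim_iff[THEN iffD1, OF kk_top, rule_format, OF compare[OF s \<sigma>(2)]] .
    ultimately show ?thesis
    proof eventually_elim
      case (elim N)
      have pos: "0 < real (kk N ^ q)" using elim(3) by simp
      have N: "real (kk N ^ q) \<le> real N" using kk1[of N] by (simp only: of_nat_le_iff)
      with pos have N0: "0 < real N" by linarith
      have "s / real N powr (1 / real d) \<le> s / real (kk N ^ q) powr (1 / real d)"
        using pos N0 N s by (intro divide_left_mono powr_mono2 mult_pos_pos) (auto simp del: of_nat_power)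
      also have "\<dots> \<le> \<sigma> / real (Suc (kk N) ^ q) powr (1 / real d)" using elim(3) by blast
      finally have "cnt N (s / real N powr (1 / real d)) \<le> cnt (Suc (kk N) ^ q) (\<sigma> / real (Suc (kk N) ^ q) powr (1 / real d))"
        using kk2[of N] by (intro mono) auto
      also have "\<dots> \<le> S (Suc (kk N))" using elim(2) .
      finally have le: "cnt N (s / real N powr (1 / real d)) \<le> S (Suc (kk N))" .
      have "?R N \<le> S (Suc (kk N)) / real (kk N ^ q)"
        by (rule frac_le[OF order_trans[OF nn le] le pos N])
      with elim(1) show ?case by linarith
    qed
  qed
  have lower: "\<forall>\<^sub>F N in sequentially. u < ?R N" if u: "u < (2 * s) ^ d" for u
  proof -
    have "\<forall>\<^sub>F t in at s. u < (2 * t) ^ d"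
      using order_tendstoD(1)[OF cont[unfolded isCont_def] u] .
    then obtain \<delta> where \<delta>: "\<delta> > 0" "\<And>t. t \<noteq> s \<Longrightarrow> dist t s < \<delta> \<Longrightarrow> u < (2 * t) ^ d"
      by (auto simp: eventually_at)
    \<comment> \<open>For the lower bound both radii lie below \<open>s\<close>; the maximum with 0
      keeps \<open>\<sigma>\<close> positive.\<close>
    obtain \<sigma> where \<sigma>: "\<sigma> \<in> \<rat>" "max 0 (s - \<delta>) < \<sigma>" "\<sigma> < s"
      using Rats_dense_in_real[of "max 0 (s - \<delta>)" s] \<delta> s by auto
    obtain \<tau> where \<tau>: "\<tau> \<in> \<rat>" "\<sigma> < \<tau>" "\<tau> < s" using Rats_dense_in_real[of \<sigma> s] \<sigma> by auto
    have "u < (2 * \<sigma>) ^ d" using \<delta>(2)[of \<sigma>] \<sigma> by (auto simp: dist_real_def)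
    also have "\<dots> \<le> (\<sigma> + \<tau>) ^ d" using \<sigma> \<tau> by (intro power_mono) auto
    finally have lt: "u < (\<sigma> + \<tau>) ^ d" .
    have \<tau>0: "0 < \<tau>" using \<sigma> \<tau> by auto
    obtain S where S: "(\<lambda>k. S k / real (k ^ q)) \<longlonglongrightarrow> (\<sigma> + \<tau>) ^ d"
      "\<forall>\<^sub>F k in sequentially. cnt (k ^ q) (\<sigma> / real (k ^ q) powr (1 / real d)) \<le> S k \<and>
                               S k \<le> cnt (k ^ q) (\<tau> / real (k ^ q) powr (1 / real d))"
      using L[of \<sigma> \<tau>] \<sigma> \<tau> by auto
    have "(\<lambda>k. S k / real (k ^ q) / (real (Suc k ^ q) / real (k ^ q))) \<longlonglongrightarrow> (\<sigma> + \<tau>) ^ d / 1"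
      by (intro tendsto_divide ratio S(1)) auto
    moreover have "\<forall>\<^sub>F k in sequentially. S k / real (k ^ q) / (real (Suc k ^ q) / real (k ^ q)) = S k / real (Suc k ^ q)"
      using eventually_gt_at_top[of 0] by eventually_elim (simp del: of_nat_Suc power_Suc)
    ultimately have "(\<lambda>k. S k / real (Suc k ^ q)) \<longlonglongrightarrow> (\<sigma> + \<tau>) ^ d"
      unfolding div_by_1 by (rule Lim_transform_eventually)
    from order_tendstoD(1)[OF filterlim_compose[OF this kk_top] lt]
    have "\<forall>\<^sub>F N in sequentially. u < S (kk N) / real (Suc (kk N) ^ q)" .
    moreover have "\<forall>\<^sub>F N in sequentially. S (kk N) \<le> cnt (kk N ^ q) (\<tau> / real (kk N ^ q) powr (1 / real d))"
      using filterlim_iff[THEN iffD1, OF kk_top, rule_format, OF S(2)] by eventually_elim auto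
    moreover have "\<forall>\<^sub>F N in sequentially. kk N > 0 \<and>
        \<tau> / real (kk N ^ q) powr (1 / real d) \<le> s / real (Suc (kk N) ^ q) powr (1 / real d)"
      using filterlim_iff[THEN iffD1, OF kk_top, rule_format, OF compare[OF \<tau>0 \<tau>(3)]] .
    ultimately show ?thesis
    proof eventually_elim
      case (elim N)
      have "0 < real (kk N ^ q)" using elim(3) by simp
      moreover have "real (kk N ^ q) \<le> real N" using kk1[of N] by (simp only: of_nat_le_iff)
      ultimately have pos: "0 < real N" by linarith
      have N: "real N \<le> real (Suc (kk N) ^ q)" using kk2[of N] by (simp only: of_nat_le_iff less_imp_le)
      have "\<tau> / real (kk N ^ q) powr (1 / real d) \<le> s / real (Suc (kk N) ^ q) powr (1 / real d)" using elim(3) by blast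
      also have "\<dots> \<le> s / real N powr (1 / real d)"
        using pos N s by (intro divide_left_mono powr_mono2 mult_pos_pos) auto
      finally have "cnt (kk N ^ q) (\<tau> / real (kk N ^ q) powr (1 / real d)) \<le> cnt N (s / real N powr (1 / real d))"
        using kk1[of N] by (intro mono) auto
      with elim(2) have le: "S (kk N) \<le> cnt N (s / real N powr (1 / real d))" by linarith
      have "S (kk N) / real (Suc (kk N) ^ q) \<le> cnt N (s / real N powr (1 / real d)) / real (Suc (kk N) ^ q)"
        by (intro divide_right_mono le) simp
      also have "\<dots> \<le> ?R N"
        using pos N nn by (intro divide_left_mono) auto
      finally show ?case using elim(1) by linarith
    qed
  qed
  show ?thesis by (intro order_tendstoI upper lower)
qed

section \<open>Smoothed pair counts along the twentieth powers\<close>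

lemma filterlim_power_sequentially:
  assumes "q > 0"
  shows "filterlim (\<lambda>k::nat. k ^ q) sequentially sequentially"
proof (rule filterlim_at_top_mono[OF filterlim_ident])
  show "\<forall>\<^sub>F k::nat in sequentially. k \<le> k ^ q"
    using eventually_ge_at_top[of 1] by eventually_elim (use assms in \<open>auto intro: self_le_power\<close>)
qed

lemma tendsto_over_root_sequentially:
  assumes "d > 0"
  shows "(\<lambda>N. t / real N powr (1 / real d)) \<longlonglongrightarrow> 0"
proof -
  have "0 < 1 / real d" using assms by simp
  thus ?thesis by real_asymp
qed

text \<open>The variance bound divided by the square of \<open>N\<close> has exponent at most -1/10,
  and along \<open>k ^ 20\<close> this becomes the summable
  \<open>1 / (real k)\<^sup>2\<close>.\<close>

lemma AE_smoothed_pair_correlation: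
  fixes x :: "nat \<Rightarrow> real"
  assumes d: "CARD('d::finite) \<ge> 3"
    and gap: "\<And>n. n \<ge> 1 \<Longrightarrow> x (n + 1) - x n \<ge> c" and c: "0 < c" "c \<le> 1"
    and e: "e \<le> 29 / 10 - 1 / real CARD('d)"
    and E: "(\<lambda>N. real (additive_energy x N)) \<in> O(\<lambda>N. real N powr e)"
    and st: "0 < \<sigma>" "\<sigma> < \<tau>"
  defines "S \<equiv> \<lambda>N (\<alpha> :: real ^ 'd). \<Sum>p\<in>offdiag N. \<Prod>i\<in>UNIV.
     trapezoid (\<sigma> / real N powr (1 / real CARD('d))) (\<tau> / real N powr (1 / real CARD('d))) ((x (fst p) - x (snd p)) * \<alpha> $ i)"
  shows "AE \<alpha> in fejer_measure_vec c. (\<lambda>k. S (k ^ 20) \<alpha> / real (k ^ 20)) \<longlonglongrightarrow> (\<sigma> + \<tau>) ^ CARD('d)"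
proof -
  let ?d = "CARD('d)"
  let ?M = "fejer_measure_vec c :: (real ^ 'd) measure"
  define a where "a N = \<sigma> / real N powr (1 / real ?d)" for N
  define b where "b N = \<tau> / real N powr (1 / real ?d)" for N
  define F where "F N p (\<alpha> :: real ^ 'd) = (\<Prod>i\<in>UNIV. trapezoid (a N) (b N) ((x (fst p) - x (snd p)) * \<alpha> $ i))" for N p \<alpha>
  define V where "V N (\<alpha> :: real ^ 'd) = (\<Sum>p\<in>offdiag N. F N p \<alpha> - (a N + b N) ^ ?d)" for N \<alpha>
  obtain C where C: "C > 0" "\<forall>\<^sub>F N in sequentially. real (additive_energy x N) \<le> C * real N powr e"
    using landau_o.bigE[OF E] by auto
  define K where "K = real ?d * (\<sigma> + \<tau>) ^ (?d - 1) * ((7 * (\<sigma> + \<tau>) / (\<tau> - \<sigma>))\<^sup>2 * C)"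
  have b_small: "\<forall>\<^sub>F N in sequentially. b N < 1/2"
  proof -
    have "b \<longlonglongrightarrow> 0" unfolding b_def by (rule tendsto_over_root_sequentially) simp
    thus ?thesis by (rule order_tendstoD) simp
  qed
  have var: "\<forall>\<^sub>F N in sequentially. integrable ?M (\<lambda>\<alpha>. (V N \<alpha> / real N)\<^sup>2) \<and>
     (\<integral>\<alpha>. (V N \<alpha> / real N)\<^sup>2 \<partial>?M) \<le> K * real N powr (- 1 / 10)"
    using b_small C(2) eventually_gt_at_top[of 0]
  proof eventually_elim
    case (elim N)
    have N: "real N > 0" "real N \<ge> 1" using elim(3) by auto
    have ab: "0 < a N" "a N < b N" "b N < 1/2"
      using st N elim(1) by (auto simp: a_def b_def divide_strict_right_mono)
    have z: "c \<le> \<bar>x (fst p) - x (snd p)\<bar>" if "p \<in> offdiag N" for p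
      using that by (intro gap_le_abs_diff[of c x] gap c(1)) (auto simp: offdiag_def)
    note tv = trapezoid_variance[OF c(1) ab finite_offdiag z sum_tent_le_additive_energy[OF c], where 'd = 'd]
    have i: "integrable ?M (\<lambda>\<alpha>. (V N \<alpha>)\<^sup>2)"
      unfolding V_def F_def by (rule tv(1))
    have le: "(\<integral>\<alpha>. (V N \<alpha>)\<^sup>2 \<partial>?M) \<le> real ?d * (a N + b N) ^ (?d - 1) *
        ((\<Sum>k. \<bar>trapezoid_coeff (a N) (b N) k\<bar>)\<^sup>2 * real (additive_energy x N))"
      unfolding V_def F_def by (rule tv(2))
    have "(\<Sum>k. \<bar>trapezoid_coeff (a N) (b N) k\<bar>) \<le> 7 * (a N + b N) / (b N - a N)"
      by (rule trapezoid_coeff_suminf_le[OF ab])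
    also have "\<dots> = 7 * (\<sigma> + \<tau>) / (\<tau> - \<sigma>)"
      using N by (simp add: a_def b_def flip: add_divide_distrib diff_divide_distrib)
    finally have "(\<Sum>k. \<bar>trapezoid_coeff (a N) (b N) k\<bar>)\<^sup>2 \<le> (7 * (\<sigma> + \<tau>) / (\<tau> - \<sigma>))\<^sup>2"
      using trapezoid_coeff_summable[OF ab(1,2)] by (intro power_mono suminf_nonneg) auto
    hence c1: "(\<Sum>k. \<bar>trapezoid_coeff (a N) (b N) k\<bar>)\<^sup>2 * real (additive_energy x N)
        \<le> (7 * (\<sigma> + \<tau>) / (\<tau> - \<sigma>))\<^sup>2 * (C * real N powr e)"
      using elim(2) by (intro mult_mono) auto
    have "(a N + b N) ^ (?d - 1) = (\<sigma> + \<tau>) ^ (?d - 1) * (real N powr (- 1 / real ?d)) ^ (?d - 1)"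
      using N by (simp add: a_def b_def powr_minus_divide power_mult_distrib power_divide flip: add_divide_distrib)
    also have "(real N powr (- 1 / real ?d)) ^ (?d - 1) = real N powr (1 / real ?d - 1)"
    proof -
      have "real (?d - 1) * (- 1 / real ?d) = 1 / real ?d - 1"
        using d by (simp add: of_nat_diff field_simps)
      thus ?thesis using N by (simp only: powr_power)
    qed
    finally have c2: "(a N + b N) ^ (?d - 1) = (\<sigma> + \<tau>) ^ (?d - 1) * real N powr (1 / real ?d - 1)" .
    have "(\<integral>\<alpha>. (V N \<alpha>)\<^sup>2 \<partial>?M) \<le> real ?d * (a N + b N) ^ (?d - 1) * ((7 * (\<sigma> + \<tau>) / (\<tau> - \<sigma>))\<^sup>2 * (C * real N powr e))"
      using ab by (intro order_trans[OF le] mult_left_mono c1) auto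
    also have "\<dots> = K * (real N powr (1 / real ?d - 1) * real N powr e)"
      unfolding c2 K_def by simp
    also have "\<dots> = K * real N powr (1 / real ?d - 1 + e)" by (simp add: powr_add)
    \<comment> \<open>The assumption on \<open>e\<close> enters here:
      \<open>1 / real ?d - 1 + e\<close> is at most \<open>29 / 10 - 1\<close>.\<close>
    also have "\<dots> \<le> K * real N powr (19 / 10)"
      using e N st C by (intro mult_left_mono powr_mono) (auto simp: K_def)
    finally have "(\<integral>\<alpha>. (V N \<alpha>)\<^sup>2 \<partial>?M) / (real N)\<^sup>2 \<le> K * real N powr (19 / 10) / (real N)\<^sup>2"
      by (intro divide_right_mono) auto
    also have "\<dots> = K * (real N powr (19 / 10) / real N powr 2)" using N by simp
    also have "\<dots> = K * real N powr (- 1 / 10)" by (simp only: powr_diff[symmetric]) simp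
    finally show ?case using i by (simp add: power_divide)
  qed
  have top: "filterlim (\<lambda>k::nat. k ^ 20) sequentially sequentially"
    by (rule filterlim_power_sequentially) (rule zero_less_numeral)
  have "\<forall>\<^sub>F k in sequentially. integrable ?M (\<lambda>\<alpha>. (V (k ^ 20) \<alpha> / real (k ^ 20))\<^sup>2) \<and>
     (\<integral>\<alpha>. (V (k ^ 20) \<alpha> / real (k ^ 20))\<^sup>2 \<partial>?M) \<le> K * (1 / (real k)\<^sup>2)"
    using filterlim_iff[THEN iffD1, OF top, rule_format, OF var] eventually_gt_at_top[of 0]
  proof eventually_elim
    case (elim k)
    have "real (k ^ 20) powr (- 1 / 10) = (real k powr 20) powr (- 1 / 10)"
      using elim(2) by simp
    also have "\<dots> = real k powr (- 2)" by (simp only: powr_powr) simp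
    also have "\<dots> = 1 / (real k)\<^sup>2" using elim(2) by (simp add: powr_minus_divide)
    finally show ?case using elim(1) by (simp only:)
  qed
  hence "AE \<alpha> in ?M. (\<lambda>k. (V (k ^ 20) \<alpha> / real (k ^ 20))\<^sup>2) \<longlonglongrightarrow> 0"
  proof (rule AE_tendsto_0_if_summable_integral)
    show "summable (\<lambda>k. K * (1 / (real k)\<^sup>2))"
      using inverse_power_summable[of 2, where 'a = real] by (intro summable_mult) (simp add: inverse_eq_divide)
  qed simp
  thus ?thesis
  proof eventually_elim
    case (elim \<alpha>)
    from tendsto_real_sqrt[OF elim] have "(\<lambda>k. \<bar>V (k ^ 20) \<alpha> / real (k ^ 20)\<bar>) \<longlonglongrightarrow> 0"
      by (simp only: real_sqrt_abs real_sqrt_zero)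
    hence V0: "(\<lambda>k. V (k ^ 20) \<alpha> / real (k ^ 20)) \<longlonglongrightarrow> 0" by (rule tendsto_rabs_zero_cancel)
    \<comment> \<open>The mean of the smoothed count over \<open>N\<close> is
      \<open>(\<sigma> + \<tau>) ^ ?d\<close> times \<open>1 - 1 / real N\<close>; the correction
      comes from the excluded diagonal.\<close>
    have "(\<lambda>k. (\<sigma> + \<tau>) ^ ?d * (1 - 1 / real (k ^ 20))) \<longlonglongrightarrow> (\<sigma> + \<tau>) ^ ?d * (1 - 0)"
      by (intro tendsto_mult tendsto_diff tendsto_const filterlim_compose[OF lim_1_over_n top])
    from tendsto_add[OF V0 this]
    have "(\<lambda>k. V (k ^ 20) \<alpha> / real (k ^ 20) + (\<sigma> + \<tau>) ^ ?d * (1 - 1 / real (k ^ 20))) \<longlonglongrightarrow> (\<sigma> + \<tau>) ^ ?d" by simp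
    moreover have "V N \<alpha> / real N + (\<sigma> + \<tau>) ^ ?d * (1 - 1 / real N) = S N \<alpha> / real N" if "N > 0" for N
    proof -
      have "(a N + b N) ^ ?d = (\<sigma> + \<tau>) ^ ?d / (real N powr (1 / real ?d)) ^ ?d"
        by (simp add: a_def b_def power_divide flip: add_divide_distrib)
      also have "(real N powr (1 / real ?d)) ^ ?d = real N"
        using that by (simp add: powr_power)
      finally have "real (card (offdiag N)) * (a N + b N) ^ ?d = (\<sigma> + \<tau>) ^ ?d * (real N - 1)"
        using that by (simp add: card_offdiag of_nat_diff field_simps)
      moreover have "V N \<alpha> = S N \<alpha> - real (card (offdiag N)) * (a N + b N) ^ ?d"
        by (simp add: V_def S_def F_def a_def b_def sum_subtractf)
      ultimately have "V N \<alpha> = S N \<alpha> - (\<sigma> + \<tau>) ^ ?d * (real N - 1)" by simp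
      thus ?thesis using that by (simp add: field_simps)
    qed
    hence "V (k ^ 20) \<alpha> / real (k ^ 20) + (\<sigma> + \<tau>) ^ ?d * (1 - 1 / real (k ^ 20)) = S (k ^ 20) \<alpha> / real (k ^ 20)"
      if "k > 0" for k using that by (simp only: zero_less_power)
    hence "\<forall>\<^sub>F k in sequentially. V (k ^ 20) \<alpha> / real (k ^ 20) + (\<sigma> + \<tau>) ^ ?d * (1 - 1 / real (k ^ 20)) = S (k ^ 20) \<alpha> / real (k ^ 20)"
      by (intro eventually_mono[OF eventually_gt_at_top[of 0]])
    ultimately show ?case by (rule Lim_transform_eventually)
  qed
qed

section \<open>From rational smoothing radii to every positive s\<close>

theorem theorem1p1:
  fixes x :: "nat \<Rightarrow> real"
  assumes "CARD('d::finite) \<ge> 3"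
    and "\<And>n. n \<ge> 1 \<Longrightarrow> x n > 0"
    and "\<exists>c>0. \<forall>n\<ge>1. x (n + 1) - x n \<ge> c"
    and "\<exists>\<delta>>0. (\<lambda>N. real (additive_energy x N)) \<in>
           O(\<lambda>N. real N powr (183 / 76 + 16 / 76 * (1 - 1 / real CARD('d)) - \<delta>))"
  shows "AE \<alpha> in (lebesgue :: (real ^ 'd) measure).
           infnorm_PPC (\<lambda>n. \<chi> i. frac (x n * \<alpha> $ i))"
proof -
  let ?d = "CARD('d)"
  obtain c0 where c0: "c0 > 0" "\<And>n. n \<ge> 1 \<Longrightarrow> x (n + 1) - x n \<ge> c0" using assms(3) by blast
  \<comment> \<open>The gap is lowered to at most 1, as the comparison of the tent with the energy
    threshold requires.\<close>
  define c where "c = min c0 1"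
  have c: "0 < c" "c \<le> 1" and gap: "\<And>n. n \<ge> 1 \<Longrightarrow> x (n + 1) - x n \<ge> c"
    using c0(1) order_trans[OF min.cobounded1 c0(2), of _ 1] by (auto simp: c_def)
  obtain \<delta> where \<delta>: "\<delta> > 0" and E: "(\<lambda>N. real (additive_energy x N)) \<in>
           O(\<lambda>N. real N powr (183 / 76 + 16 / 76 * (1 - 1 / real ?d) - \<delta>))" (is "_ \<in> O(\<lambda>N. real N powr ?e)")
    using assms(4) by blast
  \<comment> \<open>With \<open>1 / real ?d \<le> 1 / 3\<close> the two sides compare as 219/76 <
    29/10 after moving \<open>1 / real ?d\<close> to the left.\<close>
  have "1 / real ?d \<le> 1 / 3" using assms(1) by (intro divide_left_mono) auto
  hence e: "?e \<le> 29 / 10 - 1 / real ?d" using \<delta> by argo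
  let ?S = "\<lambda>\<sigma> \<tau> N (\<alpha> :: real ^ 'd). \<Sum>p\<in>offdiag N. \<Prod>i\<in>UNIV.
     trapezoid (\<sigma> / real N powr (1 / real ?d)) (\<tau> / real N powr (1 / real ?d)) ((x (fst p) - x (snd p)) * \<alpha> $ i)"
  \<comment> \<open>Indexing the radii by the countable type of rationals gives one null set for all
    pairs.\<close>
  have "AE \<alpha> in lebesgue. 0 < real_of_rat \<sigma> \<longrightarrow> real_of_rat \<sigma> < real_of_rat \<tau> \<longrightarrow>
      (\<lambda>k. ?S (real_of_rat \<sigma>) (real_of_rat \<tau>) (k ^ 20) \<alpha> / real (k ^ 20)) \<longlonglongrightarrow> (real_of_rat \<sigma> + real_of_rat \<tau>) ^ ?d" for \<sigma> \<tau>
    using AE_lebesgue_if_AE_fejer_measure_vec[OF c(1)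
        AE_smoothed_pair_correlation[OF assms(1) gap c e E, of "real_of_rat \<sigma>" "real_of_rat \<tau>"]]
    by (cases "0 < real_of_rat \<sigma> \<and> real_of_rat \<sigma> < real_of_rat \<tau>") auto
  hence "AE \<alpha> in lebesgue. \<forall>\<sigma> \<tau>. 0 < real_of_rat \<sigma> \<longrightarrow> real_of_rat \<sigma> < real_of_rat \<tau> \<longrightarrow>
      (\<lambda>k. ?S (real_of_rat \<sigma>) (real_of_rat \<tau>) (k ^ 20) \<alpha> / real (k ^ 20)) \<longlonglongrightarrow> (real_of_rat \<sigma> + real_of_rat \<tau>) ^ ?d"
    unfolding AE_all_countable by blast
  thus ?thesis
  proof eventually_elim
    case (elim \<alpha>)
    show ?case
      unfolding infnorm_PPC_def pair_corr_infnorm_frac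
    proof (intro allI impI)
      fix s :: real assume s: "s > 0"
      show "(\<lambda>N. frac_pair_count x \<alpha> N (s / real N powr (1 / real ?d)) / real N) \<longlonglongrightarrow> (2 * s) ^ ?d"
      proof (rule tendsto_of_polynomial_subsequence[where q = 20])
        fix \<sigma> \<tau> :: real assume st: "\<sigma> \<in> \<rat>" "\<tau> \<in> \<rat>" "0 < \<sigma>" "\<sigma> < \<tau>"
        have "(\<lambda>k. ?S \<sigma> \<tau> (k ^ 20) \<alpha> / real (k ^ 20)) \<longlonglongrightarrow> (\<sigma> + \<tau>) ^ ?d"
          using elim st by (auto elim!: Rats_cases)
        moreover have "\<forall>\<^sub>F k in sequentially. frac_pair_count x \<alpha> (k ^ 20) (\<sigma> / real (k ^ 20) powr (1 / real ?d)) \<le> ?S \<sigma> \<tau> (k ^ 20) \<alpha> \<and>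
              ?S \<sigma> \<tau> (k ^ 20) \<alpha> \<le> frac_pair_count x \<alpha> (k ^ 20) (\<tau> / real (k ^ 20) powr (1 / real ?d))"
        proof -
          have "(\<lambda>k::nat. \<tau> / real (k ^ 20) powr (1 / real ?d)) \<longlonglongrightarrow> 0"
            by (rule filterlim_compose[OF tendsto_over_root_sequentially filterlim_power_sequentially]) auto
          hence "\<forall>\<^sub>F k::nat in sequentially. \<tau> / real (k ^ 20) powr (1 / real ?d) < 1 / 2" by (rule order_tendstoD) simp
          thus ?thesis using eventually_gt_at_top[of 0]
          proof eventually_elim
            case (elim k)
            have "0 < \<sigma> / real (k ^ 20) powr (1 / real ?d)"
              "\<sigma> / real (k ^ 20) powr (1 / real ?d) < \<tau> / real (k ^ 20) powr (1 / real ?d)"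
              using elim(2) st by (auto intro!: divide_strict_right_mono simp del: of_nat_power)
            from frac_pair_count_trapezoid[OF this elim(1)] show ?case by blast
          qed
        qed
        ultimately show "\<exists>S. (\<lambda>k. S k / real (k ^ 20)) \<longlonglongrightarrow> (\<sigma> + \<tau>) ^ ?d \<and>
         (\<forall>\<^sub>F k in sequentially. frac_pair_count x \<alpha> (k ^ 20) (\<sigma> / real (k ^ 20) powr (1 / real ?d)) \<le> S k \<and>
                               S k \<le> frac_pair_count x \<alpha> (k ^ 20) (\<tau> / real (k ^ 20) powr (1 / real ?d)))"
          by (intro exI[of _ "\<lambda>k. ?S \<sigma> \<tau> (k ^ 20) \<alpha>"] conjI)
      qed (use s frac_pair_count_mono in \<open>auto simp: frac_pair_count_def\<close>)
    qed
  qed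
qed

end
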